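(* The five complete projective special Kähler manifolds obtained via the supergravity r-map from the following five projective special real surfaces in $\mathbb{R}^3$ (coordinates $(x,y,z)$) are pairwise non-isometric: a) $\{xyz=1,\ x>0,\ y>0\}$, b) $\{x(xy-z^2)=1,\ x>0\}$, c) $\{x(yz+x^2)=1,\ x<0,\ y>0\}$, d) $\{z(x^2+y^2-z^2)=1,\ z<0\}$, e) $\{x(y^2-z^2)+y^3=1,\ y<0,\ x>0\}$.
   Context: Projective special real manifolds. Let $h$ be a homogeneous cubic polynomial function on $\mathbb{R}^{n+1}$ and $U\subset\mathbb{R}^{n+1}$ a domain invariant under multiplication by positive numbers with $h|_U>0$. The hypersurface $\mathcal{H}=\{x\in U\mid h(x)=1\}$ is called a projective special real manifold (a surface if $n=2$) if the tensor field $g_{\mathcal{H}}$ on $\mathcal{H}$ obtained by restricting the negative Hessian $-\partial^2h$ to $T\mathcal{H}\times T\mathcal{H}$ is positive definite. Here $U=\mathbb{R}^{>0}\cdot\mathcal{H}$. Supergravity r-map. It assigns to a projective special real manifold $\mathcal{H}=\{x\in U\mid h(x)=1\}\subset\mathbb{R}^{n+1}$, defined by a homogeneous cubic polynomial $h$ and endowed with the Riemannian metric $g_{\mathcal{H}}=-\partial^2h|_{T\mathcal{H}\times T\mathcal{H}}$, the Kähler manifold $(M,g_M)$ of complex dimension $n+1$, where $M=\mathbb{R}^{n+1}+iU\subset\mathbb{C}^{n+1}$ with $U=\mathbb{R}^{>0}\cdot\mathcal{H}$, holomorphic coordinates $z^\mu=y^\mu+ix^\mu$ ($x\in U$, $y\in\mathbb{R}^{n+1}$),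 and $g_M=2\sum_{\mu,\nu}\frac{\partial^2K}{\partial z^\mu\partial\bar z^\nu}dz^\mu d\bar z^\nu$ with $K(z,\bar z)=-\log h(x)$. In each of the five cases $h$ is the cubic polynomial whose value is set equal to $1$ in the description of the surface. (The manifolds in the image of the supergravity r-map are so-called projective special Kähler manifolds; the claim concerns only the Riemannian manifolds $(M,g_M)$ just defined.) *)

theory Defs
  imports "HOL-Analysis.Analysis"
begin

section \<open>Projective special real manifolds\<close>

definition homogeneous_cubic :: "(real^'n \<Rightarrow> real) \<Rightarrow> bool" where
  "homogeneous_cubic h \<longleftrightarrow>
     (\<exists>c. \<forall>x. h x = (\<Sum>i\<in>UNIV. \<Sum>j\<in>UNIV. \<Sum>k\<in>UNIV. c i j k * x $ i * x $ j * x $ k))"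

definition hessian :: "('a::real_normed_vector \<Rightarrow> real) \<Rightarrow> 'a \<Rightarrow> 'a \<Rightarrow> 'a \<Rightarrow> real" where
  "hessian h x u v = frechet_derivative (\<lambda>w. frechet_derivative h (at w) v) (at x) u"

text \<open>The tangent space of the level set at \<open>x\<close> is the kernel of the derivative of \<open>h\<close> at \<open>x\<close>.\<close>

definition projective_special_real :: "(real^'n \<Rightarrow> real) \<Rightarrow> (real^'n) set \<Rightarrow> bool" where
  "projective_special_real h H \<longleftrightarrow>
     homogeneous_cubic h \<and>
     (\<exists>U. open U \<and> connected U \<and> U \<noteq> {} \<and>
          (\<forall>x\<in>U. \<forall>r>0. r *\<^sub>R x \<in> U) \<and>
          (\<forall>x\<in>U. h x > 0) \<and>
          H = {x \<in> U. h x = 1}) \<and>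
     (\<forall>x\<in>H. \<forall>v. v \<noteq> 0 \<and> frechet_derivative h (at x) v = 0 \<longrightarrow> - hessian h x v v > 0)"

section \<open>Riemannian isometries between open sets\<close>

text \<open>A Riemannian manifold carried by an open subset of a Euclidean space is given as the pair
  of this subset and its metric tensor \<open>g p u v\<close>, where \<open>u\<close>, \<open>v\<close> are tangent vectors at \<open>p\<close>.\<close>

type_synonym 'a riemannian = "'a set \<times> ('a \<Rightarrow> 'a \<Rightarrow> 'a \<Rightarrow> real)"

text \<open>Only meaningful for open \<open>S\<close>; for the spaces considered here (of finite dimension)
  this is the usual class of \<open>k\<close> times continuously differentiable maps.\<close>

primrec Ck_on :: "nat \<Rightarrow> 'a set \<Rightarrow> ('a::euclidean_space \<Rightarrow> 'b::euclidean_space) \<Rightarrow> bool" where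
  "Ck_on 0 S f \<longleftrightarrow> continuous_on S f"
| "Ck_on (Suc k) S f \<longleftrightarrow>
     (\<forall>x\<in>S. f differentiable (at x)) \<and>
     (\<forall>v. Ck_on k S (\<lambda>x. frechet_derivative f (at x) v))"

definition smooth_on :: "'a set \<Rightarrow> ('a::euclidean_space \<Rightarrow> 'b::euclidean_space) \<Rightarrow> bool" where
  "smooth_on S f \<longleftrightarrow> (\<forall>k. Ck_on k S f)"

definition riemannian_isometry ::
    "'a::euclidean_space riemannian \<Rightarrow> 'b::euclidean_space riemannian \<Rightarrow> ('a \<Rightarrow> 'b) \<Rightarrow> bool" where
  "riemannian_isometry M N f \<longleftrightarrow>
     bij_betw f (fst M) (fst N) \<and>
     smooth_on (fst M) f \<and>
     smooth_on (fst N) (inv_into (fst M) f) \<and>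
     (\<forall>p\<in>fst M. \<forall>u v.
        snd N (f p) (frechet_derivative f (at p) u) (frechet_derivative f (at p) v) = snd M p u v)"

definition isometric_riemannian ::
    "'a::euclidean_space riemannian \<Rightarrow> 'b::euclidean_space riemannian \<Rightarrow> bool" where
  "isometric_riemannian M N \<longleftrightarrow> (\<exists>f. riemannian_isometry M N f)"

section \<open>The supergravity r-map\<close>

text \<open>Wirtinger derivatives with respect to the coordinates \<open>z $ \<mu> = y $ \<mu> + \<i> * x $ \<mu>\<close>. The roles
  of \<open>x\<close> and \<open>y\<close> are not the customary ones: \<open>y\<close> is the real part and \<open>x\<close> the imaginary part.\<close>

definition d_z :: "'n \<Rightarrow> (complex^'n \<Rightarrow> complex) \<Rightarrow> complex^'n \<Rightarrow> complex" where
  "d_z \<mu> f z = (frechet_derivative f (at z) (axis \<mu> 1)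
                - \<i> * frechet_derivative f (at z) (axis \<mu> \<i>)) / 2"

definition d_zbar :: "'n \<Rightarrow> (complex^'n \<Rightarrow> complex) \<Rightarrow> complex^'n \<Rightarrow> complex" where
  "d_zbar \<mu> f z = (frechet_derivative f (at z) (axis \<mu> 1)
                   + \<i> * frechet_derivative f (at z) (axis \<mu> \<i>)) / 2"

definition Im_vec :: "complex^'n \<Rightarrow> real^'n" where
  "Im_vec z = (\<chi> \<mu>. Im (z $ \<mu>))"

definition positive_cone :: "(real^'n) set \<Rightarrow> (real^'n) set" where
  "positive_cone H = {r *\<^sub>R x | r x. 0 < r \<and> x \<in> H}"

definition kaehler_potential :: "(real^'n \<Rightarrow> real) \<Rightarrow> complex^'n \<Rightarrow> complex" where
  "kaehler_potential h z = of_real (- ln (h (Im_vec z)))"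

text \<open>The product of \<open>dz\<^sup>\<mu>\<close> and the conjugate of \<open>dz\<^sup>\<nu>\<close> in the metric is the symmetric product
  \<open>a b = (a \<otimes> b + b \<otimes> a) / 2\<close>; contracting it with the Hermitian matrix of the mixed second
  derivatives gives the real part below. Tangent vectors are elements of \<open>complex^'n\<close>, with
  \<open>dz\<^sup>\<mu> u = u $ \<mu>\<close>.\<close>

definition r_map_metric ::
    "(real^'n \<Rightarrow> real) \<Rightarrow> complex^'n \<Rightarrow> complex^'n \<Rightarrow> complex^'n \<Rightarrow> real" where
  "r_map_metric h z u v =
     2 * Re (\<Sum>\<mu>\<in>UNIV. \<Sum>\<nu>\<in>UNIV.
               d_z \<mu> (d_zbar \<nu> (kaehler_potential h)) z * (u $ \<mu>) * cnj (v $ \<nu>))"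

definition r_map :: "(real^'n \<Rightarrow> real) \<Rightarrow> (real^'n) set \<Rightarrow> (complex^'n) riemannian" where
  "r_map h H = ({z. Im_vec z \<in> positive_cone H}, r_map_metric h)"

section \<open>The five surfaces\<close>

datatype surface_label = Surf_a | Surf_b | Surf_c | Surf_d | Surf_e

fun cubic :: "surface_label \<Rightarrow> real^3 \<Rightarrow> real" where
  "cubic Surf_a p = (let x = p$1; y = p$2; z = p$3 in x * y * z)"
| "cubic Surf_b p = (let x = p$1; y = p$2; z = p$3 in x * (x * y - z^2))"
| "cubic Surf_c p = (let x = p$1; y = p$2; z = p$3 in x * (y * z + x^2))"
| "cubic Surf_d p = (let x = p$1; y = p$2; z = p$3 in z * (x^2 + y^2 - z^2))"
| "cubic Surf_e p = (let x = p$1; y = p$2; z = p$3 in x * (y^2 - z^2) + y^3)"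

fun sign_conditions :: "surface_label \<Rightarrow> real^3 \<Rightarrow> bool" where
  "sign_conditions Surf_a p \<longleftrightarrow> p$1 > 0 \<and> p$2 > 0"
| "sign_conditions Surf_b p \<longleftrightarrow> p$1 > 0"
| "sign_conditions Surf_c p \<longleftrightarrow> p$1 < 0 \<and> p$2 > 0"
| "sign_conditions Surf_d p \<longleftrightarrow> p$3 < 0"
| "sign_conditions Surf_e p \<longleftrightarrow> p$2 < 0 \<and> p$1 > 0"

definition surface :: "surface_label \<Rightarrow> (real^3) set" where
  "surface s = {p. cubic s p = 1 \<and> sign_conditions s p}"

section \<open>The five surfaces are projective special real\<close>

lemma homogeneous_cubic_cubic: "homogeneous_cubic (cubic s)"
proof (cases s)
  case Surf_a
  show ?thesis unfolding homogeneous_cubic_def Surf_a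
    by (rule exI[of _ "\<lambda>i j k. if (i, j, k) = (1, 2, 3) then 1 else 0"])
       (simp add: sum_3 Let_def)
next
  case Surf_b
  show ?thesis unfolding homogeneous_cubic_def Surf_b
    by (rule exI[of _ "\<lambda>i j k. if (i, j, k) = (1, 1, 2) then 1
                               else if (i, j, k) = (1, 3, 3) then -1 else 0"])
       (simp add: sum_3 Let_def power2_eq_square algebra_simps)
next
  case Surf_c
  show ?thesis unfolding homogeneous_cubic_def Surf_c
    by (rule exI[of _ "\<lambda>i j k. if (i, j, k) \<in> {(1, 2, 3), (1, 1, 1)} then 1 else 0"])
       (simp add: sum_3 Let_def power2_eq_square algebra_simps)
next
  case Surf_d
  show ?thesis unfolding homogeneous_cubic_def Surf_d
    by (rule exI[of _ "\<lambda>i j k. if (i, j, k) \<in> {(3, 1, 1), (3, 2, 2)} then 1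
                               else if (i, j, k) = (3, 3, 3) then -1 else 0"])
       (simp add: sum_3 Let_def power2_eq_square algebra_simps)
next
  case Surf_e
  show ?thesis unfolding homogeneous_cubic_def Surf_e
    by (rule exI[of _ "\<lambda>i j k. if (i, j, k) \<in> {(1, 2, 2), (2, 2, 2)} then 1
                               else if (i, j, k) = (1, 3, 3) then -1 else 0"])
       (simp add: sum_3 Let_def power2_eq_square power3_eq_cube algebra_simps)
qed

definition cubic_region :: "surface_label \<Rightarrow> (real^3) set" where
  "cubic_region s = {p. cubic s p > 0 \<and> sign_conditions s p}"

lemma cubic_scaleR: "cubic s (r *\<^sub>R p) = r^3 * cubic s p"
  by (cases s) (simp_all add: Let_def power2_eq_square power3_eq_cube algebra_simps)

lemma sign_conditions_scaleR: "0 < r \<Longrightarrow> sign_conditions s p \<Longrightarrow> sign_conditions s (r *\<^sub>R p)"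
  by (cases s) (auto simp: mult_pos_neg)

lemma positive_cone_surface: "positive_cone (surface s) = cubic_region s"
proof (intro equalityI subsetI)
  fix p assume "p \<in> cubic_region s"
  then have p: "cubic s p > 0" "sign_conditions s p" by (auto simp: cubic_region_def)
  define r where "r = root 3 (cubic s p)"
  have r: "r > 0" "r^3 = cubic s p" using p(1) by (simp_all add: r_def)
  have "(1/r) *\<^sub>R p \<in> surface s"
    using p r by (simp add: surface_def cubic_scaleR sign_conditions_scaleR power_one_over field_simps)
  moreover have "p = r *\<^sub>R ((1/r) *\<^sub>R p)" using r by simp
  ultimately show "p \<in> positive_cone (surface s)"
    unfolding positive_cone_def using r(1) by blast
qed (auto simp: positive_cone_def cubic_region_def surface_def cubic_scaleR sign_conditions_scaleR)

lemma open_cubic_region: "open (cubic_region s)"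
  unfolding cubic_region_def
  by (cases s; simp add: Let_def;
      intro open_Collect_conj open_Collect_less continuous_intros)

fun dcubic :: "surface_label \<Rightarrow> real^3 \<Rightarrow> real^3 \<Rightarrow> real" where
  "dcubic Surf_a p v = v$1 * p$2 * p$3 + p$1 * v$2 * p$3 + p$1 * p$2 * v$3"
| "dcubic Surf_b p v = (2 * p$1 * p$2 - (p$3)^2) * v$1 + (p$1)^2 * v$2 - 2 * p$1 * p$3 * v$3"
| "dcubic Surf_c p v = (3 * (p$1)^2 + p$2 * p$3) * v$1 + p$1 * p$3 * v$2 + p$1 * p$2 * v$3"
| "dcubic Surf_d p v = 2 * p$1 * p$3 * v$1 + 2 * p$2 * p$3 * v$2 + ((p$1)^2 + (p$2)^2 - 3 * (p$3)^2) * v$3"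
| "dcubic Surf_e p v = ((p$2)^2 - (p$3)^2) * v$1 + (2 * p$1 * p$2 + 3 * (p$2)^2) * v$2 - 2 * p$1 * p$3 * v$3"

fun ddcubic :: "surface_label \<Rightarrow> real^3 \<Rightarrow> real^3 \<Rightarrow> real^3 \<Rightarrow> real" where
  "ddcubic Surf_a p u v = p$1 * (u$2 * v$3 + u$3 * v$2) + p$2 * (u$1 * v$3 + u$3 * v$1) + p$3 * (u$1 * v$2 + u$2 * v$1)"
| "ddcubic Surf_b p u v = 2 * p$2 * u$1 * v$1 + 2 * p$1 * (u$1 * v$2 + u$2 * v$1) - 2 * p$3 * (u$1 * v$3 + u$3 * v$1) - 2 * p$1 * u$3 * v$3"
| "ddcubic Surf_c p u v = 6 * p$1 * u$1 * v$1 + p$1 * (u$2 * v$3 + u$3 * v$2) + p$2 * (u$1 * v$3 + u$3 * v$1) + p$3 * (u$1 * v$2 + u$2 * v$1)"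
| "ddcubic Surf_d p u v = 2 * p$3 * (u$1 * v$1 + u$2 * v$2 - 3 * u$3 * v$3) + 2 * p$1 * (u$1 * v$3 + u$3 * v$1) + 2 * p$2 * (u$2 * v$3 + u$3 * v$2)"
| "ddcubic Surf_e p u v = 2 * p$2 * (u$1 * v$2 + u$2 * v$1) - 2 * p$3 * (u$1 * v$3 + u$3 * v$1) + (2 * p$1 + 6 * p$2) * u$2 * v$2 - 2 * p$1 * u$3 * v$3"

lemma nth_has_derivative: "((\<lambda>p::real^3. p $ i) has_derivative (\<lambda>v. v $ i)) F"
  by (rule bounded_linear.has_derivative[OF bounded_linear_vec_nth has_derivative_ident])

lemma cubic_has_derivative: "(cubic s has_derivative dcubic s p) (at p)"
proof -
  have "((\<lambda>p. cubic s p) has_derivative (\<lambda>v. dcubic s p v)) (at p)"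
    by (cases s; simp only: cubic.simps Let_def dcubic.simps;
        rule has_derivative_eq_rhs, (rule nth_has_derivative derivative_intros)+,
        simp add: fun_eq_iff power2_eq_square power3_eq_cube algebra_simps)
  then show ?thesis by simp
qed

lemma frechet_derivative_cubic: "frechet_derivative (cubic s) (at p) = dcubic s p"
  by (metis cubic_has_derivative frechet_derivative_at)

lemma hessian_cubic: "hessian (cubic s) p u v = ddcubic s p u v"
proof -
  have "((\<lambda>q. dcubic s q v) has_derivative (\<lambda>u. ddcubic s p u v)) (at p)"
    by (cases s; simp only: dcubic.simps ddcubic.simps;
        rule has_derivative_eq_rhs, (rule nth_has_derivative derivative_intros)+,
        simp add: fun_eq_iff power2_eq_square algebra_simps)
  then show ?thesis unfolding hessian_def frechet_derivative_cubic
    by (metis frechet_derivative_at)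
qed

lemma quadratic_form_pos:
  fixes a b c x y :: real
  assumes "a > 0" "4 * a * c > b\<^sup>2" "x \<noteq> 0 \<or> y \<noteq> 0"
  shows "a * x\<^sup>2 + b * x * y + c * y\<^sup>2 > 0"
proof -
  have "4 * a * (a * x\<^sup>2 + b * x * y + c * y\<^sup>2) = (2 * a * x + b * y)\<^sup>2 + (4 * a * c - b\<^sup>2) * y\<^sup>2"
    by (simp add: power2_eq_square algebra_simps)
  also have "\<dots> > 0"
  proof (cases "y = 0")
    case True then show ?thesis using assms by simp
  next
    case False then show ?thesis using assms(2) by (intro add_nonneg_pos mult_pos_pos) auto
  qed
  finally show ?thesis using assms(1) by (simp add: zero_less_mult_iff)
qed

lemma ddcubic_neg:
  assumes p: "cubic s p = 1" "sign_conditions s p" and v: "v \<noteq> 0" "dcubic s p v = 0"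
  shows "ddcubic s p v v < 0"
proof -
  define x y z a b c where defs: "x = p$1" "y = p$2" "z = p$3" "a = v$1" "b = v$2" "c = v$3"
  note D = defs[symmetric]
  have nz: "a \<noteq> 0 \<or> b \<noteq> 0 \<or> c \<noteq> 0"
    using v(1) by (auto simp: vec_eq_iff forall_3 defs)
  define Q where "Q = - ddcubic s p v v"
  have "Q > 0"
  proof (cases s)
    case Surf_a
    have h: "x * y * z = 1" "x > 0" "y > 0" using p Surf_a by (auto simp: D Let_def)
    have z: "z > 0" using h by (metis mult_pos_pos zero_less_mult_pos zero_less_one)
    have T: "a * y * z + x * b * z + x * y * c = 0" using v(2) Surf_a by (simp add: D)
    have Q: "Q = - 2 * (x * b * c + y * a * c + z * a * b)" 
      by (simp add: Q_def Surf_a D algebra_simps)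
    have ab: "a \<noteq> 0 \<or> b \<noteq> 0" using T nz h by auto
    have "x * y * Q = 2 * z * y\<^sup>2 * a\<^sup>2 + (2 * z * x * y) * a * b + 2 * z * x\<^sup>2 * b\<^sup>2
             - 2 * (x * b + y * a) * (a * y * z + x * b * z + x * y * c)"
      unfolding Q by (simp add: power2_eq_square algebra_simps)
    also have "\<dots> = 2 * z * y\<^sup>2 * a\<^sup>2 + (2 * z * x * y) * a * b + 2 * z * x\<^sup>2 * b\<^sup>2" using T by simp
    also have "\<dots> > 0"
    proof (rule quadratic_form_pos[OF _ _ ab])
      have "0 < 12 * z^2 * x^2 * y^2" using h z by simp
      also have "12 * z^2 * x^2 * y^2 = 4 * (2 * z * y\<^sup>2) * (2 * z * x\<^sup>2) - (2 * z * x * y)\<^sup>2"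
        by (simp add: power2_eq_square algebra_simps)
      finally show "(2 * z * x * y)\<^sup>2 < 4 * (2 * z * y\<^sup>2) * (2 * z * x\<^sup>2)" by simp
    qed (use h z in simp)
    finally show ?thesis by (rule zero_less_mult_pos) (use h in simp)
  next
    case Surf_b
    have h: "x * (x * y - z\<^sup>2) = 1" "x > 0" using p Surf_b by (auto simp: D Let_def)
    have pos: "x * y - z\<^sup>2 > 0" using h by (metis zero_less_mult_pos zero_less_one)
    have T: "(2 * x * y - z\<^sup>2) * a + x\<^sup>2 * b - 2 * x * z * c = 0" using v(2) Surf_b by (simp add: D)
    have Q: "Q = - 2 * y * a\<^sup>2 - 4 * x * a * b + 4 * z * a * c + 2 * x * c\<^sup>2" 
      by (simp add: Q_def Surf_b D power2_eq_square algebra_simps)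
    have ac: "a \<noteq> 0 \<or> c \<noteq> 0" using T nz h by auto
    have "x * Q = 6 * (x * y - z\<^sup>2) * a\<^sup>2 + 2 * (x * c - z * a)\<^sup>2
             - 4 * a * ((2 * x * y - z\<^sup>2) * a + x\<^sup>2 * b - 2 * x * z * c)"
      unfolding Q by (simp add: power2_eq_square algebra_simps)
    also have "\<dots> = 6 * (x * y - z\<^sup>2) * a\<^sup>2 + 2 * (x * c - z * a)\<^sup>2" using T by simp
    also have "\<dots> > 0"
    proof (cases "a = 0")
      case True then show ?thesis using ac h by simp
    next
      case False then show ?thesis using pos by (intro add_pos_nonneg) auto
    qed
    finally show ?thesis by (rule zero_less_mult_pos) (use h in simp)
  next
    case Surf_c
    have h: "x * (y * z + x\<^sup>2) = 1" "x < 0" "y > 0" using p Surf_c by (auto simp: D Let_def)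
    have neg: "y * z + x\<^sup>2 < 0" using h by (smt (verit) mult_nonpos_nonneg)
    have yz: "y * z < 0" using neg by (smt (verit) zero_le_power2)
    have z: "z < 0" using yz h by (simp add: mult_less_0_iff)
    have T: "(3 * x\<^sup>2 + y * z) * a + x * z * b + x * y * c = 0" using v(2) Surf_c by (simp add: D)
    have Q: "Q = - (6 * x * a\<^sup>2 + 2 * x * b * c + 2 * y * a * c + 2 * z * a * b)" 
      by (simp add: Q_def Surf_c D power2_eq_square algebra_simps)
    have ab: "a \<noteq> 0 \<or> b \<noteq> 0" using T nz h by auto
    have "(- x * y) * Q = (- 2 * y\<^sup>2 * z) * a\<^sup>2 + (- 6 * x^3 - 2 * x * y * z) * a * b + (- 2 * x\<^sup>2 * z) * b\<^sup>2
             + 2 * (x * b + y * a) * ((3 * x\<^sup>2 + y * z) * a + x * z * b + x * y * c)"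
      unfolding Q by (simp add: power2_eq_square power3_eq_cube algebra_simps)
    also have "\<dots> = (- 2 * y\<^sup>2 * z) * a\<^sup>2 + (- 6 * x^3 - 2 * x * y * z) * a * b + (- 2 * x\<^sup>2 * z) * b\<^sup>2"
      using T by simp
    also have "\<dots> > 0"
    proof (rule quadratic_form_pos[OF _ _ ab])
      have "y * z - 3 * x\<^sup>2 < 0" using yz by (smt (verit) zero_le_power2)
      then have "0 < 12 * x\<^sup>2 * ((y * z - 3 * x\<^sup>2) * (y * z + x\<^sup>2))"
        using neg h by (intro mult_pos_pos mult_neg_neg) auto
      also have "\<dots> = 4 * (- 2 * y\<^sup>2 * z) * (- 2 * x\<^sup>2 * z) - (- 6 * x^3 - 2 * x * y * z)\<^sup>2"
        by (simp add: power2_eq_square power3_eq_cube algebra_simps)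
      finally show "(- 6 * x^3 - 2 * x * y * z)\<^sup>2 < 4 * (- 2 * y\<^sup>2 * z) * (- 2 * x\<^sup>2 * z)" by simp
    qed (use h z in \<open>simp add: mult_pos_neg\<close>)
    finally have "0 < (- x * y) * Q" .
    moreover have "- x * y > 0" using h by (simp add: mult_neg_pos)
    ultimately show ?thesis by (rule zero_less_mult_pos)
  next
    case Surf_d
    have h: "z * (x\<^sup>2 + y\<^sup>2 - z\<^sup>2) = 1" "z < 0" using p Surf_d by (auto simp: D Let_def)
    have neg: "x\<^sup>2 + y\<^sup>2 - z\<^sup>2 < 0" using h by (smt (verit) mult_nonpos_nonneg)
    define R where "R = x\<^sup>2 + y\<^sup>2"
    define m where "m = 3 * z\<^sup>2 - R"
    have R: "0 \<le> R" "R < z\<^sup>2" using neg by (auto simp: R_def)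
    have m: "0 < m" "2 * R < m" using R by (auto simp: m_def)
    have T: "2 * x * z * a + 2 * y * z * b + (x\<^sup>2 + y\<^sup>2 - 3 * z\<^sup>2) * c = 0"
      using v(2) Surf_d by (simp add: D)
    have Q: "Q = - 2 * z * (a\<^sup>2 + b\<^sup>2) + 6 * z * c\<^sup>2 - 4 * (x * a + y * b) * c" 
      by (simp add: Q_def Surf_d D power2_eq_square algebra_simps)
    have mc: "m * c = 2 * z * (x * a + y * b)" using T by (simp add: m_def R_def algebra_simps)
    have ab: "a \<noteq> 0 \<or> b \<noteq> 0" using mc nz m by auto
    then have n: "a\<^sup>2 + b\<^sup>2 > 0" by (simp add: sum_power2_gt_zero_iff)
    have "(x * a + y * b)\<^sup>2 + (x * b - y * a)\<^sup>2 = R * (a\<^sup>2 + b\<^sup>2)"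
      by (simp add: R_def power2_eq_square algebra_simps)
    then have CS: "(x * a + y * b)\<^sup>2 \<le> R * (a\<^sup>2 + b\<^sup>2)" by (smt (verit) zero_le_power2)
    have "m\<^sup>2 * (R * c\<^sup>2) = R * (m * c)\<^sup>2" by (simp add: power2_eq_square algebra_simps)
    also have "\<dots> = 4 * R * z\<^sup>2 * (x * a + y * b)\<^sup>2"
      unfolding mc by (simp add: power2_eq_square algebra_simps)
    also have "\<dots> \<le> 4 * R * z\<^sup>2 * (R * (a\<^sup>2 + b\<^sup>2))"
      using CS R by (intro mult_left_mono) auto
    also have "\<dots> = (2 * R)\<^sup>2 * (z\<^sup>2 * (a\<^sup>2 + b\<^sup>2))" by (simp add: power2_eq_square algebra_simps)
    also have "\<dots> < m\<^sup>2 * (z\<^sup>2 * (a\<^sup>2 + b\<^sup>2))"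
      using m R n h by (intro mult_strict_right_mono power_strict_mono) auto
    finally have lt: "R * c\<^sup>2 < z\<^sup>2 * (a\<^sup>2 + b\<^sup>2)" using m by simp
    have "(- z) * Q = 2 * (z\<^sup>2 * (a\<^sup>2 + b\<^sup>2) - R * c\<^sup>2)
             + 2 * c * (2 * x * z * a + 2 * y * z * b + (x\<^sup>2 + y\<^sup>2 - 3 * z\<^sup>2) * c)"
      unfolding Q R_def by (simp add: power2_eq_square algebra_simps)
    also have "\<dots> = 2 * (z\<^sup>2 * (a\<^sup>2 + b\<^sup>2) - R * c\<^sup>2)" using T by simp
    also have "\<dots> > 0" using lt by simp
    finally have "0 < (- z) * Q" .
    moreover have "- z > 0" using h by simp
    ultimately show ?thesis by (rule zero_less_mult_pos)
  next
    case Surf_e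
    have h: "x * (y\<^sup>2 - z\<^sup>2) + y^3 = 1" "x > 0" "y < 0" using p Surf_e by (auto simp: D Let_def)
    have "y^3 < 0" using h by simp
    then have "x * (y\<^sup>2 - z\<^sup>2) > 0" using h by linarith
    then have d: "y\<^sup>2 - z\<^sup>2 > 0" using h by (simp add: zero_less_mult_iff)
    have T: "(y\<^sup>2 - z\<^sup>2) * a + (2 * x * y + 3 * y\<^sup>2) * b - 2 * x * z * c = 0"
      using v(2) Surf_e by (simp add: D)
    have Q: "Q = - 4 * y * a * b + 4 * z * a * c - (2 * x + 6 * y) * b\<^sup>2 + 2 * x * c\<^sup>2" 
      by (simp add: Q_def Surf_e D power2_eq_square algebra_simps)
    have cb: "c \<noteq> 0 \<or> b \<noteq> 0" using T nz d by auto
    let ?A = "2 * x * (y\<^sup>2 + 3 * z\<^sup>2)" and ?B = "- 16 * x * y * z - 12 * y\<^sup>2 * z"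
      and ?C = "6 * x * y\<^sup>2 + 6 * y^3 + 2 * x * z\<^sup>2 + 6 * y * z\<^sup>2"
    have "(y\<^sup>2 - z\<^sup>2) * Q = ?A * c\<^sup>2 + ?B * c * b + ?C * b\<^sup>2
             + 4 * (z * c - y * b) * ((y\<^sup>2 - z\<^sup>2) * a + (2 * x * y + 3 * y\<^sup>2) * b - 2 * x * z * c)"
      unfolding Q by (simp add: power2_eq_square power3_eq_cube algebra_simps)
    also have "\<dots> = ?A * c\<^sup>2 + ?B * c * b + ?C * b\<^sup>2" using T by simp
    also have "\<dots> > 0"
    proof (rule quadratic_form_pos[OF _ _ cb])
      show "?A > 0" using h by (simp add: add_pos_nonneg)
      have "y * z\<^sup>2 \<le> 0" using h by (simp add: mult_nonpos_nonneg)
      then have "0 < 48 * (x * (y\<^sup>2 - z\<^sup>2) + y^3) * (x * (y\<^sup>2 - z\<^sup>2) - 3 * y * z\<^sup>2)"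
        using h \<open>x * (y\<^sup>2 - z\<^sup>2) > 0\<close> by (intro mult_pos_pos) auto
      also have "\<dots> = 4 * ?A * ?C - ?B\<^sup>2"
        by (simp add: power2_eq_square power3_eq_cube algebra_simps)
      finally show "?B\<^sup>2 < 4 * ?A * ?C" by simp
    qed
    finally show ?thesis by (rule zero_less_mult_pos) (use d in simp)
  qed
  then show ?thesis by (simp add: Q_def)
qed


lemma continuous_on_vector_3:
  fixes f g h :: "'a::topological_space \<Rightarrow> real"
  assumes "continuous_on S f" "continuous_on S g" "continuous_on S h"
  shows "continuous_on S (\<lambda>p. vector [f p, g p, h p] :: real^3)"
proof -
  have "continuous_on S (\<lambda>p. (vector [f p, g p, h p] :: real^3) $ i)" for i
    using assms exhaust_3[of i] by auto
  then have "continuous_on S (\<lambda>p. \<chi> i. (vector [f p, g p, h p] :: real^3) $ i)"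
    by (rule continuous_on_vec_lambda)
  then show ?thesis by simp
qed

lemma cubic_region_eq_image:
  assumes "\<And>q. q \<in> S \<Longrightarrow> f q \<in> cubic_region s"
    and "\<And>x y z. vector [x, y, z] \<in> cubic_region s \<Longrightarrow> g x y z \<in> S \<and> f (g x y z) = vector [x, y, z]"
  shows "cubic_region s = f ` S"
proof (intro equalityI subsetI)
  fix p assume p: "p \<in> cubic_region s"
  have "p = vector [p$1, p$2, p$3]" by (simp add: vec_eq_iff forall_3)
  then show "p \<in> f ` S" using p assms(2)[of "p$1" "p$2" "p$3"] by (metis image_eqI)
qed (use assms(1) in auto)

lemma convex_image_connected:
  fixes S :: "'a::real_normed_vector set"
  assumes "R = f ` S" "continuous_on S f" "convex S" "q \<in> S"
  shows "connected R \<and> R \<noteq> {}"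
  using assms by (auto intro: connected_continuous_image convex_connected)

lemma connected_cubic_region: "connected (cubic_region s)"
  and cubic_region_nonempty: "cubic_region s \<noteq> {}"
proof -
  note [simp] = cubic_region_def Let_def
  have "connected (cubic_region s) \<and> cubic_region s \<noteq> {}"
  proof (cases s)
    case Surf_a
    let ?f = "\<lambda>(x, y, z). vector [x, y, z] :: real^3"
    let ?S = "{0<..} \<times> {0<..} \<times> {0<..} :: (real \<times> real \<times> real) set"
    have "cubic_region s = ?f ` ?S"
    proof (rule cubic_region_eq_image[where g = "\<lambda>x y z. (x, y, z)"])
      fix x y z :: real assume "vector [x, y, z] \<in> cubic_region s"
      then show "(x, y, z) \<in> ?S \<and> ?f (x, y, z) = vector [x, y, z]"
        using Surf_a zero_less_mult_pos[of "x * y" z] by auto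
    qed (auto simp: Surf_a)
    moreover have "continuous_on ?S ?f"
      unfolding case_prod_unfold by (intro continuous_on_vector_3 continuous_intros)
    moreover have "convex ?S" by (intro convex_Times convex_real_interval)
    moreover have "(1, 1, 1) \<in> ?S" by simp
    ultimately show ?thesis by (rule convex_image_connected)
  next
    case Surf_b
    let ?f = "\<lambda>(x, w, z). vector [x, (z\<^sup>2 + w) / x, z] :: real^3"
    let ?S = "{0<..} \<times> {0<..} \<times> UNIV :: (real \<times> real \<times> real) set"
    have "cubic_region s = ?f ` ?S"
    proof (rule cubic_region_eq_image[where g = "\<lambda>x y z. (x, x * y - z\<^sup>2, z)"])
      fix x y z :: real assume "vector [x, y, z] \<in> cubic_region s"
      then show "(x, x * y - z\<^sup>2, z) \<in> ?S \<and> ?f (x, x * y - z\<^sup>2, z) = vector [x, y, z]"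
        using Surf_b by (auto simp: zero_less_mult_iff)
    qed (auto simp: Surf_b)
    moreover have "continuous_on ?S ?f"
      unfolding case_prod_unfold by (intro continuous_on_vector_3 continuous_intros) auto
    moreover have "convex ?S" by (intro convex_Times convex_real_interval convex_UNIV)
    moreover have "(1, 1, 1) \<in> ?S" by simp
    ultimately show ?thesis by (rule convex_image_connected)
  next
    case Surf_c
    let ?f = "\<lambda>(x, y, w). vector [x, y, - (x\<^sup>2 + w) / y] :: real^3"
    let ?S = "{..<0} \<times> {0<..} \<times> {0<..} :: (real \<times> real \<times> real) set"
    have "cubic_region s = ?f ` ?S"
    proof (rule cubic_region_eq_image[where g = "\<lambda>x y z. (x, y, - (y * z + x\<^sup>2))"])
      fix x y z :: real assume "vector [x, y, z] \<in> cubic_region s"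
      then have "x < 0" "y > 0" "x * (y * z + x\<^sup>2) > 0" using Surf_c by auto
      moreover from this have "y * z + x\<^sup>2 < 0" by (smt (verit) mult_nonpos_nonneg)
      ultimately show "(x, y, - (y * z + x\<^sup>2)) \<in> ?S \<and> ?f (x, y, - (y * z + x\<^sup>2)) = vector [x, y, z]"
        by auto
    qed (auto simp: Surf_c mult_neg_pos)
    moreover have "continuous_on ?S ?f"
      unfolding case_prod_unfold by (intro continuous_on_vector_3 continuous_intros) auto
    moreover have "convex ?S" by (intro convex_Times convex_real_interval)
    moreover have "(-1, 1, 1) \<in> ?S" by simp
    ultimately show ?thesis by (rule convex_image_connected)
  next
    case Surf_d
    let ?f = "\<lambda>(r, w). vector [r * Re w, r * Im w, - r] :: real^3"
    let ?S = "{0<..} \<times> ball 0 1 :: (real \<times> complex) set"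
    have "cubic_region s = ?f ` ?S"
    proof (rule cubic_region_eq_image[where g = "\<lambda>x y z. (- z, Complex (- x / z) (- y / z))"])
      fix x y z :: real assume "vector [x, y, z] \<in> cubic_region s"
      then have "z < 0" "x\<^sup>2 + y\<^sup>2 < z\<^sup>2" using Surf_d by (auto simp: zero_less_mult_iff)
      moreover from this have "cmod (Complex (- x / z) (- y / z)) < 1"
        by (simp add: cmod_def power_divide flip: add_divide_distrib)
      ultimately show "(- z, Complex (- x / z) (- y / z)) \<in> ?S \<and>
                       ?f (- z, Complex (- x / z) (- y / z)) = vector [x, y, z]"
        by simp
    next
      fix q assume "q \<in> ?S"
      then obtain r w where q: "q = (r, w)" "r > 0" "cmod w < 1" by auto
      have "(Re w)\<^sup>2 + (Im w)\<^sup>2 < 1" using q by (simp add: cmod_def)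
      then have "- (r ^ 3) * ((Re w)\<^sup>2 + (Im w)\<^sup>2 - 1) > 0" using q by (intro mult_neg_neg) auto
      then show "?f q \<in> cubic_region s"
        using q by (simp add: Surf_d power2_eq_square power3_eq_cube algebra_simps)
    qed
    moreover have "continuous_on ?S ?f"
      unfolding case_prod_unfold by (intro continuous_on_vector_3 continuous_intros)
    moreover have "convex ?S" by (intro convex_Times convex_real_interval convex_ball)
    moreover have "(1, 0) \<in> ?S" by simp
    ultimately show ?thesis by (rule convex_image_connected)
  next
    case Surf_e
    let ?k = "\<lambda>w t::real. sqrt (t\<^sup>2 - t^3 / (t + w))"
    let ?f = "\<lambda>(w, t, r). vector [t + w, - t, r * ?k w t] :: real^3"
    let ?S = "{0<..} \<times> {0<..} \<times> {-1<..<1} :: (real \<times> real \<times> real) set"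
    have k: "t\<^sup>2 - t^3 / (t + w) > 0" if "w > 0" "t > 0" for w t :: real
      using that by (simp add: field_simps power2_eq_square power3_eq_cube)
    have "cubic_region s = ?f ` ?S"
    proof (rule cubic_region_eq_image[where g = "\<lambda>x y z. (x + y, - y, z / ?k (x + y) (- y))"])
      fix x y z :: real assume "vector [x, y, z] \<in> cubic_region s"
      then have xy: "x > 0" "y < 0" and h: "x * (y\<^sup>2 - z\<^sup>2) + y^3 > 0" using Surf_e by auto
      have "y\<^sup>2 * (x + y) = x * y\<^sup>2 + y^3" by (simp add: power2_eq_square power3_eq_cube algebra_simps)
      also have "\<dots> \<ge> x * (y\<^sup>2 - z\<^sup>2) + y^3" using xy by (simp add: algebra_simps)
      finally have "y\<^sup>2 * (x + y) > 0" using h by linarith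
      then have pos: "x + y > 0" by (rule zero_less_mult_pos) (use xy in simp)
      have "z\<^sup>2 < y\<^sup>2 + y^3 / x" using h xy by (simp add: field_simps)
      then have "\<bar>z\<bar> < ?k (x + y) (- y)" by (simp add: real_less_rsqrt)
      moreover define K where "K = ?k (x + y) (- y)"
      ultimately have K: "\<bar>z\<bar> < K" by (simp only:)
      then have "K > 0" by linarith
      with K have "- 1 < z / K" "z / K < 1" "z / K * K = z" by (auto simp: field_simps)
      then have "(x + y, - y, z / K) \<in> ?S \<and> ?f (x + y, - y, z / K) = vector [x, y, z]"
        using pos xy unfolding prod.case K_def[symmetric] by simp
      then show "(x + y, - y, z / ?k (x + y) (- y)) \<in> ?S \<and>
                 ?f (x + y, - y, z / ?k (x + y) (- y)) = vector [x, y, z]"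
        unfolding K_def .
    next
      fix q assume "q \<in> ?S"
      then obtain w t r where q: "q = (w, t, r)" "w > 0" "t > 0" "\<bar>r\<bar> < 1" by auto
      have r: "r\<^sup>2 < 1" using q by (simp add: abs_square_less_1)
      define E where "E = t^3 / (t + w)"
      have E: "t^3 = (t + w) * E" using q by (simp add: E_def)
      have "0 < (t + w) * ((1 - r\<^sup>2) * (t\<^sup>2 - E))"
        using r q k[of w t] by (intro mult_pos_pos) (auto simp: E_def)
      also have "\<dots> = (t + w) * (t\<^sup>2 - r\<^sup>2 * (t\<^sup>2 - E)) - t^3"
        unfolding E by (simp add: algebra_simps)
      also have "r\<^sup>2 * (t\<^sup>2 - E) = (r * ?k w t)\<^sup>2"
        using k[of w t] q by (simp add: E_def power_mult_distrib)
      finally show "?f q \<in> cubic_region s"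
        using q by (simp add: Surf_e)
    qed
    moreover have "continuous_on ?S ?f"
      unfolding case_prod_unfold by (intro continuous_on_vector_3 continuous_intros) auto
    moreover have "convex ?S" by (intro convex_Times convex_real_interval)
    moreover have "(1, 1, 0) \<in> ?S" by simp
    ultimately show ?thesis by (rule convex_image_connected)
  qed
  then show "connected (cubic_region s)" "cubic_region s \<noteq> {}" by blast+
qed

lemma projective_special_real_surface: "projective_special_real (cubic s) (surface s)"
proof -
  have "\<forall>x\<in>cubic_region s. \<forall>r>0. r *\<^sub>R x \<in> cubic_region s"
    by (auto simp: cubic_region_def cubic_scaleR sign_conditions_scaleR)
  moreover have "\<forall>x\<in>cubic_region s. cubic s x > 0" by (auto simp: cubic_region_def)
  moreover have "surface s = {x \<in> cubic_region s. cubic s x = 1}"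
    by (auto simp: cubic_region_def surface_def)
  moreover have "- hessian (cubic s) x v v > 0"
    if "x \<in> surface s" "v \<noteq> 0" "frechet_derivative (cubic s) (at x) v = 0" for x v
    using that ddcubic_neg[of s x v]
    by (simp add: surface_def hessian_cubic frechet_derivative_cubic)
  ultimately show ?thesis
    unfolding projective_special_real_def
    by (intro conjI exI[of _ "cubic_region s"] homogeneous_cubic_cubic open_cubic_region
              connected_cubic_region cubic_region_nonempty) auto
qed

end

theory Submission
  imports Defs
begin

text \<open>The scalar curvature tells the five manifolds apart. On a tube domain with metric
  \<open>G / 2\<close> in both the real and the imaginary directions, \<open>G = - \<partial>\<^sup>2 log h\<close>, the Ricci form is
  \<open>- 1/2\<close> times the Hessian of \<open>log det G\<close>, and for a cubic \<open>h\<close> in \<open>n\<close> variables \<open>det G\<close> is up to a constant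
  \<open>d / h^n\<close>, where \<open>d\<close> is the Hessian determinant of \<open>h\<close>. In three variables this gives the scalar curvature
  \<open>2 \<sigma> - 15\<close> with \<open>\<sigma> = h tr ((\<partial>\<^sup>2 h)\<^sup>-\<^sup>1 \<partial>\<^sup>2 log d)\<close>. For the five surfaces \<open>\<sigma>\<close> is constantly \<open>3/2\<close> (a),
  constantly \<open>0\<close> (b), strictly between \<open>0\<close> and \<open>3/2\<close> (c), negative (d), and of both signs (e).\<close>

section \<open>Symmetry of second derivatives\<close>

text \<open>On a tube domain nothing depends on the real part, so mixed derivatives in z and its
  conjugate are a quarter of real Hessians; this turns the Kaehler formula for the Ricci form into
  the stated one. \<open>G\<close> is a rank one change of -H/h, with H the Hessian of h. By Euler,
  H maps x to twice the gradient of h, so the matrix determinant lemma gives det G = (-1)^n (1 -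
  3/2) d / h^n, and the inverse of \<open>G\<close> has a closed form as well. In the Hessian
  \<Lambda> of log det G the factor h^(-n) contributes n G, so tracing with the inverse of
  \<open>G\<close> yields n^2 - \<sigma> + \<theta>(x,x)/2, where \<theta> is the Hessian of log d
  and \<theta>(x,x) = -n because d has degree n. For n = 3 the scalar curvature is -2 (9 - \<sigma>
  - 3/2). An isometry here is merely a real diffeomorphism, so holomorphic formulas cannot be
  transported along it. Invariance is therefore shown for the Levi-Civita connection in real
  coordinates, and the Kaehler structure only guides the choice of \<Gamma>. Since \<sigma> can
  vary, its ranges on the five cones are compared.\<close>

lemma second_difference_limit:
  fixes f :: "'a::real_normed_vector \<Rightarrow> real"
  assumes "open S" "p \<in> S"
    and f: "\<And>x. x \<in> S \<Longrightarrow> (f has_derivative f' x) (at x)"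
    and f': "((\<lambda>x. f' x u) has_derivative f'') (at p)"
  shows "((\<lambda>t. (f (p + t *\<^sub>R u + t *\<^sub>R w) - f (p + t *\<^sub>R u) - f (p + t *\<^sub>R w) + f p) / t\<^sup>2)
           \<longlongrightarrow> f'' w) (at_right 0)"
proof (rule tendstoI)
  fix e :: real assume e: "e > 0"
  define M where "M = norm u + norm w + 1"
  have M: "M > 0" by (simp add: M_def add_nonneg_pos)
  \<comment> \<open>\<open>M\<close> bounds the displacement from \<open>p\<close> per unit of
    \<open>t\<close>. Two errors of size \<open>e' * (t * M)\<close> will add up to
    \<open>t * (e / 2)\<close>; hence the 4.\<close>
  define e' where "e' = e / (4 * M)"
  have e': "e' > 0" using e M by (simp add: e'_def)
  obtain d1 where d1: "d1 > 0" "ball p d1 \<subseteq> S"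
    using assms(1,2) openE by blast
  interpret f'': bounded_linear f'' using f' by (rule has_derivative_bounded_linear)
  obtain d2 where d2: "d2 > 0"
    "\<And>y. norm (y - p) < d2 \<Longrightarrow> norm (f' y u - f' p u - f'' (y - p)) \<le> e' * norm (y - p)"
    using f' e' unfolding has_derivative_at_alt by blast
  define d where "d = min d1 d2 / M"
  have d: "d > 0" using d1(1) d2(1) M by (simp add: d_def)
  show "\<forall>\<^sub>F t in at_right 0. dist ((f (p + t *\<^sub>R u + t *\<^sub>R w) - f (p + t *\<^sub>R u)
          - f (p + t *\<^sub>R w) + f p) / t\<^sup>2) (f'' w) < e"
    unfolding eventually_at_right_field
  proof (intro exI[of _ d] conjI allI impI)
    show "0 < d" by (rule d)
    fix t :: real assume t: "0 < t" "t < d"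
    have tM: "t * M < d1" "t * M < d2" using t M by (simp_all add: d_def field_simps)
    have near: "norm (s *\<^sub>R u + r *\<^sub>R w) \<le> t * M"
      if "0 \<le> s" "s \<le> t" "0 \<le> r" "r \<le> t" for s r
    proof -
      have "norm (s *\<^sub>R u + r *\<^sub>R w) \<le> s * norm u + r * norm w"
        using norm_triangle_ineq[of "s *\<^sub>R u" "r *\<^sub>R w"] that by simp
      also have "\<dots> \<le> t * norm u + t * norm w"
        using that by (intro add_mono mult_right_mono) auto
      also have "\<dots> \<le> t * M" using t by (simp add: M_def algebra_simps)
      finally show ?thesis .
    qed
    have inS: "p + s *\<^sub>R u + r *\<^sub>R w \<in> S"
      if "0 \<le> s" "s \<le> t" "0 \<le> r" "r \<le> t" for s r
    proof -
      have "p + (s *\<^sub>R u + r *\<^sub>R w) \<in> ball p d1"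
        unfolding mem_ball dist_commute[of p] using near[OF that] tM by (simp add: dist_norm)
      then show ?thesis using d1(2) by (auto simp: add.assoc)
    qed
    \<comment> \<open>\<open>k t - k 0\<close> is the numerator of the quotient. The mean value
      theorem in \<open>s\<close> makes it \<open>t\<close> times a difference of
      \<open>f' _ u\<close> at two points near \<open>p\<close>, and linearising
      \<open>f' _ u\<close> at \<open>p\<close> evaluates that up to o(t).\<close>
    define k where "k = (\<lambda>s. f (p + s *\<^sub>R u + t *\<^sub>R w) - f (p + s *\<^sub>R u))"
    have k: "(k has_derivative (\<lambda>h. h * (f' (p + s *\<^sub>R u + t *\<^sub>R w) u - f' (p + s *\<^sub>R u) u))) (at s)"
      if s: "0 \<le> s" "s \<le> t" for s
    proof -
      have 1: "p + s *\<^sub>R u + t *\<^sub>R w \<in> S" using inS[of s t] s t by auto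
      have 2: "p + s *\<^sub>R u \<in> S" using inS[of s 0] s t by auto
      interpret l1: bounded_linear "f' (p + s *\<^sub>R u + t *\<^sub>R w)"
        using f[OF 1] by (rule has_derivative_bounded_linear)
      interpret l2: bounded_linear "f' (p + s *\<^sub>R u)"
        using f[OF 2] by (rule has_derivative_bounded_linear)
      have "((\<lambda>s. f (p + s *\<^sub>R u + t *\<^sub>R w)) has_derivative
              (\<lambda>h. f' (p + s *\<^sub>R u + t *\<^sub>R w) (h *\<^sub>R u))) (at s)"
        by (rule has_derivative_compose[where g = f and f = "\<lambda>s. p + s *\<^sub>R u + t *\<^sub>R w", OF _ f[OF 1]]) (auto intro!: derivative_eq_intros)
      moreover have "((\<lambda>s. f (p + s *\<^sub>R u)) has_derivative (\<lambda>h. f' (p + s *\<^sub>R u) (h *\<^sub>R u))) (at s)"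
        by (rule has_derivative_compose[where g = f and f = "\<lambda>s. p + s *\<^sub>R u", OF _ f[OF 2]]) (auto intro!: derivative_eq_intros)
      ultimately show ?thesis unfolding k_def
        by (rule has_derivative_eq_rhs[OF has_derivative_diff])
           (simp only: l1.scaleR l2.scaleR real_scaleR_def right_diff_distrib)
    qed
    obtain s where s: "0 < s" "s < t"
      "k t - k 0 = t * (f' (p + s *\<^sub>R u + t *\<^sub>R w) u - f' (p + s *\<^sub>R u) u)"
    proof -
      note main = that
      have c: "continuous_on {0..t} k"
        by (rule has_derivative_continuous_on, rule has_derivative_at_withinI, rule k) auto
      show ?thesis
      proof (rule mvt[OF t(1) c])
        show "(k has_derivative (\<lambda>h. h * (f' (p + s *\<^sub>R u + t *\<^sub>R w) u - f' (p + s *\<^sub>R u) u))) (at s)"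
          if "0 < s" "s < t" for s using that by (intro k) auto
        show thesis if "0 < s" "s < t"
          "k t - k 0 = (t - 0) * (f' (p + s *\<^sub>R u + t *\<^sub>R w) u - f' (p + s *\<^sub>R u) u)" for s
          by (rule main[of s]) (use that in simp_all)
      qed
    qed
    have kk: "f (p + t *\<^sub>R u + t *\<^sub>R w) - f (p + t *\<^sub>R u) - f (p + t *\<^sub>R w) + f p = k t - k 0"
      by (simp add: k_def)
    have n1: "norm (s *\<^sub>R u + t *\<^sub>R w) \<le> t * M" using near[of s t] s t by auto
    have n2: "norm (s *\<^sub>R u) \<le> t * M" using near[of s 0] s t by auto
    have est: "norm (f' (p + k) u - f' p u - f'' k) \<le> e' * (t * M)" if "norm k \<le> t * M" for k
    proof -
      have "norm (f' (p + k) u - f' p u - f'' k) \<le> e' * norm k"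
        using d2(2)[of "p + k"] that tM by simp
      also have "\<dots> \<le> e' * (t * M)" using that e' by simp
      finally show ?thesis .
    qed
    have "norm (f' (p + s *\<^sub>R u + t *\<^sub>R w) u - f' p u - (s *\<^sub>R f'' u + t *\<^sub>R f'' w)) \<le> e' * (t * M)"
      using est[OF n1] by (simp only: f''.add f''.scaleR add.assoc)
    moreover have "norm (f' (p + s *\<^sub>R u) u - f' p u - s *\<^sub>R f'' u) \<le> e' * (t * M)"
      using est[OF n2] by (simp only: f''.scaleR)
    ultimately have "\<bar>(f' (p + s *\<^sub>R u + t *\<^sub>R w) u - f' (p + s *\<^sub>R u) u) - t * f'' w\<bar> \<le> 2 * (e' * (t * M))"
      unfolding real_norm_def real_scaleR_def by linarith
    also have "\<dots> = t * (e / 2)" using M by (simp add: e'_def field_simps)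
    finally have "\<bar>(f' (p + s *\<^sub>R u + t *\<^sub>R w) u - f' (p + s *\<^sub>R u) u) - t * f'' w\<bar> \<le> t * (e / 2)" .
    then have "\<bar>((f' (p + s *\<^sub>R u + t *\<^sub>R w) u - f' (p + s *\<^sub>R u) u) - t * f'' w) / t\<bar> \<le> e / 2"
      using t(1) by (simp only: abs_divide abs_of_pos divide_le_eq if_True mult.commute)
    moreover have "(k t - k 0) / t\<^sup>2 - f'' w
        = ((f' (p + s *\<^sub>R u + t *\<^sub>R w) u - f' (p + s *\<^sub>R u) u) - t * f'' w) / t"
      using t unfolding s(3) by (simp add: field_simps power2_eq_square)
    ultimately have "\<bar>(k t - k 0) / t\<^sup>2 - f'' w\<bar> \<le> e / 2" by (simp only:)
    then show "dist ((f (p + t *\<^sub>R u + t *\<^sub>R w) - f (p + t *\<^sub>R u) - f (p + t *\<^sub>R w) + f p) / t\<^sup>2) (f'' w) < e"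
      unfolding kk dist_real_def using e by linarith
  qed
qed

text \<open>The second difference is unchanged when \<open>u\<close> and \<open>w\<close> are
  exchanged, so both sides are limits of the same quotient.\<close>

lemma second_derivative_symmetric_real:
  fixes f :: "'a::real_normed_vector \<Rightarrow> real"
  assumes "open S" "p \<in> S"
    and f: "\<And>x. x \<in> S \<Longrightarrow> (f has_derivative f' x) (at x)"
    and f': "((\<lambda>x. f' x u) has_derivative Du) (at p)" "((\<lambda>x. f' x w) has_derivative Dw) (at p)"
  shows "Du w = Dw u"
proof -
  note 1 = second_difference_limit[OF assms(1-3) f'(1), of w]
  note 2 = second_difference_limit[OF assms(1-3) f'(2), of u]
  have "f (p + t *\<^sub>R u + t *\<^sub>R w) - f (p + t *\<^sub>R u) - f (p + t *\<^sub>R w) + f p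
      = f (p + t *\<^sub>R w + t *\<^sub>R u) - f (p + t *\<^sub>R w) - f (p + t *\<^sub>R u) + f p" for t
    by (simp add: algebra_simps)
  with 1 have "((\<lambda>t. (f (p + t *\<^sub>R w + t *\<^sub>R u) - f (p + t *\<^sub>R w) - f (p + t *\<^sub>R u) + f p) / t\<^sup>2)
           \<longlongrightarrow> Du w) (at_right 0)" by simp
  from tendsto_unique[OF trivial_limit_at_right_real this 2] show ?thesis .
qed

abbreviation fd :: "('a::real_normed_vector \<Rightarrow> 'b::real_normed_vector) \<Rightarrow> 'a \<Rightarrow> 'a \<Rightarrow> 'b" where
  "fd f p \<equiv> frechet_derivative f (at p)"

lemma fd_eq: "(f has_derivative f') (at p) \<Longrightarrow> fd f p = f'"
  by (metis frechet_derivative_at)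

lemma fd_symmetric:
  fixes f :: "'a::real_normed_vector \<Rightarrow> 'b::euclidean_space"
  assumes S: "open S" "p \<in> S"
    and f: "\<And>x. x \<in> S \<Longrightarrow> f differentiable at x"
    and f': "\<And>v. (\<lambda>x. fd f x v) differentiable at p"
  shows "fd (\<lambda>x. fd f x u) p w = fd (\<lambda>x. fd f x w) p u"
proof (rule euclidean_eqI)
  fix b :: 'b assume "b \<in> Basis"
  have 1: "((\<lambda>x. f x \<bullet> b) has_derivative (\<lambda>v. fd f x v \<bullet> b)) (at x)" if "x \<in> S" for x
    using f[OF that] by (intro has_derivative_inner_left) (simp add: frechet_derivative_works)
  have 2: "((\<lambda>x. fd f x v \<bullet> b) has_derivative (\<lambda>u. fd (\<lambda>x. fd f x v) p u \<bullet> b)) (at p)" for v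
    using f'[of v] by (intro has_derivative_inner_left) (simp add: frechet_derivative_works)
  from second_derivative_symmetric_real[OF S 1 2 2]
  show "fd (\<lambda>x. fd f x u) p w \<bullet> b = fd (\<lambda>x. fd f x w) p u \<bullet> b" .
qed

section \<open>Product rule for bilinear forms that vary with the point\<close>

lemma bilinear_euclidean_expand:
  fixes B :: "'b::euclidean_space \<Rightarrow> 'c::euclidean_space \<Rightarrow> 'd::real_vector"
  assumes "bilinear B"
  shows "B u v = (\<Sum>i\<in>Basis. \<Sum>j\<in>Basis. ((u \<bullet> i) * (v \<bullet> j)) *\<^sub>R B i j)"
proof -
  have "B u v = B (\<Sum>i\<in>Basis. (u \<bullet> i) *\<^sub>R i) (\<Sum>j\<in>Basis. (v \<bullet> j) *\<^sub>R j)"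
    by (simp add: euclidean_representation)
  also have "\<dots> = (\<Sum>(i,j)\<in>Basis\<times>Basis. B ((u \<bullet> i) *\<^sub>R i) ((v \<bullet> j) *\<^sub>R j))"
    by (rule bilinear_sum[OF assms])
  also have "\<dots> = (\<Sum>i\<in>Basis. \<Sum>j\<in>Basis. ((u \<bullet> i) * (v \<bullet> j)) *\<^sub>R B i j)"
    by (simp add: sum.cartesian_product bilinear_lmul[OF assms] bilinear_rmul[OF assms] mult.commute)
  finally show ?thesis .
qed

text \<open>Differentiability of \<open>B\<close> is given only for fixed arguments. Expansion in
  bases turns the expression into a finite sum of ordinary products. This is the tool for
  differentiating metrics and Christoffel tensors pulled back along a map.\<close>

lemma bilinear_field_has_derivative:
  fixes B :: "'n::real_normed_vector \<Rightarrow> 'b::euclidean_space \<Rightarrow> 'c::euclidean_space \<Rightarrow> 'd::real_normed_vector"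
  assumes T: "open T" "\<phi> p \<in> T" "\<And>q. q \<in> T \<Longrightarrow> bilinear (B q)"
    and B: "\<And>u v. ((\<lambda>q. B q u v) has_derivative B' u v) (at (\<phi> p))"
    and \<phi>: "(\<phi> has_derivative \<phi>') (at p)"
    and a: "(a has_derivative a') (at p)" and b: "(b has_derivative b') (at p)"
  shows "((\<lambda>x. B (\<phi> x) (a x) (b x)) has_derivative
          (\<lambda>u. B' (a p) (b p) (\<phi>' u) + B (\<phi> p) (a' u) (b p) + B (\<phi> p) (a p) (b' u))) (at p)"
proof -
  let ?E = "\<lambda>q u v. (\<Sum>i\<in>Basis. \<Sum>j\<in>Basis. ((u \<bullet> i) * (v \<bullet> j)) *\<^sub>R B q i j)"
  have ex: "B q u v = ?E q u v" if "q \<in> T" for q u v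
    by (rule bilinear_euclidean_expand[OF T(3)[OF that]])
  have near: "eventually (\<lambda>x. \<phi> x \<in> T) (at p)"
    using has_derivative_continuous[OF \<phi>] T(1,2) unfolding continuous_at
    by (metis topological_tendstoD)
  \<comment> \<open>Bilinearity passes from \<open>B\<close> to \<open>B'\<close>: differentiate the
    expansion and use uniqueness of derivatives.\<close>
  have B'eq: "B' u v h = (\<Sum>i\<in>Basis. \<Sum>j\<in>Basis. ((u \<bullet> i) * (v \<bullet> j)) *\<^sub>R B' i j h)" for u v h
  proof -
    have "((\<lambda>q. ?E q u v) has_derivative
            (\<lambda>h. \<Sum>i\<in>Basis. \<Sum>j\<in>Basis. ((u \<bullet> i) * (v \<bullet> j)) *\<^sub>R B' i j h)) (at (\<phi> p))"
      by (intro has_derivative_sum has_derivative_scaleR_right B)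
    then have "((\<lambda>q. B q u v) has_derivative
            (\<lambda>h. \<Sum>i\<in>Basis. \<Sum>j\<in>Basis. ((u \<bullet> i) * (v \<bullet> j)) *\<^sub>R B' i j h)) (at (\<phi> p))"
      by (rule has_derivative_transform_within_open[OF _ T(1,2)]) (simp only: ex[of _ u v])
    from has_derivative_unique[OF B[of u v] this] show ?thesis by (rule fun_cong)
  qed
  have E: "((\<lambda>x. ?E (\<phi> x) (a x) (b x)) has_derivative
          (\<lambda>h. (\<Sum>i\<in>Basis. \<Sum>j\<in>Basis. ((a p \<bullet> i) * (b p \<bullet> j)) *\<^sub>R B' i j (\<phi>' h)
             + (a p \<bullet> i * (b' h \<bullet> j) + (a' h \<bullet> i) * (b p \<bullet> j)) *\<^sub>R B (\<phi> p) i j))) (at p)"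
    by (rule has_derivative_sum[OF has_derivative_sum[OF has_derivative_scaleR[OF
          has_derivative_mult[OF has_derivative_inner_left[OF a] has_derivative_inner_left[OF b]]
          has_derivative_compose[OF \<phi> B]]]])
  have E': "(\<Sum>i\<in>Basis. \<Sum>j\<in>Basis. ((a p \<bullet> i) * (b p \<bullet> j)) *\<^sub>R B' i j (\<phi>' h)
             + (a p \<bullet> i * (b' h \<bullet> j) + (a' h \<bullet> i) * (b p \<bullet> j)) *\<^sub>R B (\<phi> p) i j)
      = B' (a p) (b p) (\<phi>' h) + B (\<phi> p) (a' h) (b p) + B (\<phi> p) (a p) (b' h)" for h
    unfolding B'eq[of "a p" "b p"] ex[OF T(2), of "a' h" "b p"] ex[OF T(2), of "a p" "b' h"]
    by (simp only: sum.distrib scaleR_add_left add_ac)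
  have eq: "eventually (\<lambda>x. ?E (\<phi> x) (a x) (b x) = B (\<phi> x) (a x) (b x)) (at p)"
    using near by (rule eventually_mono) (rule ex[symmetric])
  show ?thesis
    by (rule has_derivative_transform_eventually[OF E[unfolded E'] eq])
       (simp_all only: ex[OF T(2), of "a p" "b p"] UNIV_I)
qed

section \<open>Isometry invariance of the scalar curvature\<close>

definition operator_trace :: "('a::euclidean_space \<Rightarrow> 'a) \<Rightarrow> real" where
  "operator_trace L = (\<Sum>b\<in>Basis. L b \<bullet> b)"

lemma operator_trace_commute:
  fixes A :: "'b::euclidean_space \<Rightarrow> 'a::euclidean_space"
  assumes A: "linear A" and B: "linear B"
  shows "operator_trace (\<lambda>x. A (B x)) = operator_trace (\<lambda>x. B (A x))"
proof -
  have ex: "F (G x) \<bullet> y = (\<Sum>c\<in>Basis. (G x \<bullet> c) * (F c \<bullet> y))" if "linear F"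
    for F :: "'c::euclidean_space \<Rightarrow> 'd::euclidean_space" and G :: "'d \<Rightarrow> 'c" and x y
  proof -
    have "F (G x) = F (\<Sum>c\<in>Basis. (G x \<bullet> c) *\<^sub>R c)" by (simp only: euclidean_representation)
    also have "\<dots> = (\<Sum>c\<in>Basis. (G x \<bullet> c) *\<^sub>R F c)"
      using that by (simp add: linear_sum linear_scale)
    finally show ?thesis by (simp add: inner_sum_left)
  qed
  show ?thesis
    unfolding operator_trace_def ex[OF A] ex[OF B]
    by (subst sum.swap) (simp only: mult.commute)
qed

lemma operator_trace_conjugate:
  fixes A :: "'a::euclidean_space \<Rightarrow> 'a"
  assumes "linear A" "linear F" "linear G" "\<And>x. G (F x) = x"
  shows "operator_trace (\<lambda>x. F (A (G x))) = operator_trace A"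
  using operator_trace_commute[OF \<open>linear F\<close> linear_compose[OF \<open>linear G\<close> \<open>linear A\<close>]] assms(4)
  by (simp add: o_def)

text \<open>Nondegeneracy lets \<open>g\<close> be cancelled from an identity, and one derivative of
  each component gives meaning to the Koszul formula.\<close>

definition pseudo_riemannian :: "'a::euclidean_space riemannian \<Rightarrow> bool" where
  "pseudo_riemannian M \<longleftrightarrow> open (fst M) \<and>
     (\<forall>p\<in>fst M. bilinear (snd M p) \<and>
        (\<forall>u v. snd M p u v = snd M p v u) \<and>
        (\<forall>u. (\<forall>v. snd M p u v = 0) \<longrightarrow> u = 0) \<and>
        (\<forall>u v. (\<lambda>q. snd M q u v) differentiable at p))"

text \<open>\<open>\<Gamma> p u v\<close> is the Christoffel tensor of second kind, so that the covariant derivative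
  of a vector field \<open>X\<close> along \<open>u\<close> is \<open>fd X p u + \<Gamma> p u (X p)\<close>.\<close>

definition levi_civita :: "'a::euclidean_space riemannian \<Rightarrow> ('a \<Rightarrow> 'a \<Rightarrow> 'a \<Rightarrow> 'a) \<Rightarrow> bool" where
  "levi_civita M \<Gamma> \<longleftrightarrow>
     (\<forall>p\<in>fst M. bilinear (\<Gamma> p) \<and> (\<forall>u v. \<Gamma> p u v = \<Gamma> p v u) \<and>
        (\<forall>u v. (\<lambda>q. \<Gamma> q u v) differentiable at p) \<and>
        (\<forall>u v w. 2 * snd M p (\<Gamma> p u v) w =
           fd (\<lambda>q. snd M q v w) p u + fd (\<lambda>q. snd M q u w) p v - fd (\<lambda>q. snd M q u v) p w))"

text \<open>R(u,v)w on constant coordinate fields, whose brackets vanish.\<close>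

definition curvature ::
    "('a::euclidean_space \<Rightarrow> 'a \<Rightarrow> 'a \<Rightarrow> 'a) \<Rightarrow> 'a \<Rightarrow> 'a \<Rightarrow> 'a \<Rightarrow> 'a \<Rightarrow> 'a" where
  "curvature \<Gamma> p u v w =
     fd (\<lambda>q. \<Gamma> q v w) p u - fd (\<lambda>q. \<Gamma> q u w) p v + \<Gamma> p u (\<Gamma> p v w) - \<Gamma> p v (\<Gamma> p u w)"

definition ricci :: "('a::euclidean_space \<Rightarrow> 'a \<Rightarrow> 'a \<Rightarrow> 'a) \<Rightarrow> 'a \<Rightarrow> 'a \<Rightarrow> 'a \<Rightarrow> real" where
  "ricci \<Gamma> p v w = operator_trace (\<lambda>u. curvature \<Gamma> p u v w)"

text \<open>\<open>A\<close> is the Ricci tensor with one index raised. As a relation, a value is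
  certified by exhibiting a connection and \<open>A\<close>, with no inverse metric to be
  chosen.\<close>

definition has_scalar_curvature :: "'a::euclidean_space riemannian \<Rightarrow> 'a \<Rightarrow> real \<Rightarrow> bool" where
  "has_scalar_curvature M p k \<longleftrightarrow> (\<exists>\<Gamma> A. levi_civita M \<Gamma> \<and> linear A \<and>
      (\<forall>v w. snd M p (A v) w = ricci \<Gamma> p v w) \<and> operator_trace A = k)"

lemma pseudo_riemannianD:
  assumes "pseudo_riemannian M"
  shows "open (fst M)"
    and "p \<in> fst M \<Longrightarrow> bilinear (snd M p)"
    and "p \<in> fst M \<Longrightarrow> snd M p u v = snd M p v u"
    and "p \<in> fst M \<Longrightarrow> (\<And>v. snd M p u v = 0) \<Longrightarrow> u = 0"
    and "p \<in> fst M \<Longrightarrow> (\<lambda>q. snd M q u v) differentiable at p"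
  using assms unfolding pseudo_riemannian_def by blast+

lemma levi_civitaD:
  assumes "levi_civita M \<Gamma>" "p \<in> fst M"
  shows "bilinear (\<Gamma> p)" and "\<Gamma> p u v = \<Gamma> p v u"
    and "(\<lambda>q. \<Gamma> q u v) differentiable at p"
    and "2 * snd M p (\<Gamma> p u v) w =
           fd (\<lambda>q. snd M q v w) p u + fd (\<lambda>q. snd M q u w) p v - fd (\<lambda>q. snd M q u v) p w"
  using assms unfolding levi_civita_def by blast+

lemma smooth_on_differentiable:
  assumes "smooth_on S f" "p \<in> S"
  shows "f differentiable at p"
  using assms unfolding smooth_on_def by (metis Ck_on.simps(2))

lemma smooth_on_fd:
  assumes "smooth_on S f"
  shows "smooth_on S (\<lambda>x. fd f x v)"
  using assms unfolding smooth_on_def by (metis Ck_on.simps(2))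

lemma differentiable_at_fd:
  "f differentiable at p \<Longrightarrow> (f has_derivative fd f p) (at p)"
  by (simp add: frechet_derivative_works)

section \<open>How connection and curvature transform under an isometry\<close>

locale isometry_between =
  fixes M N :: "'a::euclidean_space riemannian" and f :: "'a \<Rightarrow> 'a" and \<Gamma> \<Gamma>' :: "'a \<Rightarrow> 'a \<Rightarrow> 'a \<Rightarrow> 'a"
  assumes iso: "riemannian_isometry M N f"
    and M: "pseudo_riemannian M" and N: "pseudo_riemannian N"
    and LC: "levi_civita M \<Gamma>" and LC': "levi_civita N \<Gamma>'"
begin

lemma smooth: "smooth_on (fst M) f"
  using iso by (simp add: riemannian_isometry_def)

lemma image_in: "p \<in> fst M \<Longrightarrow> f p \<in> fst N"
  using iso by (auto simp: riemannian_isometry_def bij_betw_def)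

lemma metric_preserved: "p \<in> fst M \<Longrightarrow> snd N (f p) (fd f p u) (fd f p v) = snd M p u v"
  using iso by (auto simp: riemannian_isometry_def)

lemma f_has_derivative: "p \<in> fst M \<Longrightarrow> (f has_derivative fd f p) (at p)"
  by (rule differentiable_at_fd[OF smooth_on_differentiable[OF smooth]])

lemma fd_has_derivative:
  "p \<in> fst M \<Longrightarrow> ((\<lambda>q. fd f q v) has_derivative fd (\<lambda>q. fd f q v) p) (at p)"
  by (rule differentiable_at_fd[OF smooth_on_differentiable[OF smooth_on_fd[OF smooth]]])

lemma fd_linear: "p \<in> fst M \<Longrightarrow> linear (fd f p)"
  using f_has_derivative has_derivative_linear by blast

text \<open>A kernel vector of \<open>fd f p\<close> would be orthogonal to everything in
  \<open>M\<close>. Injectivity suffices because both manifolds live in the same type, hence in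
  equal dimension.\<close>

lemma fd_inverse:
  assumes "p \<in> fst M"
  obtains G where "linear G" "\<And>x. G (fd f p x) = x" "\<And>x. fd f p (G x) = x"
proof -
  interpret linear "fd f p" by (rule fd_linear[OF assms])
  have "inj (fd f p)"
    unfolding inj_iff_eq_0
  proof (intro allI impI)
    fix u assume u: "fd f p u = 0"
    have "snd M p u v = 0" for v
      unfolding metric_preserved[OF assms, symmetric] u
      using pseudo_riemannianD(2)[OF N image_in[OF assms]] by (rule bilinear_lzero)
    then show "u = 0" by (rule pseudo_riemannianD(4)[OF M assms])
  qed
  from linear_injective_isomorphism[OF fd_linear[OF assms] this] that show ?thesis by blast
qed

lemma metric_derivative:
  assumes p: "p \<in> fst M"
  shows "fd (\<lambda>q. snd M q v w) p u =
      fd (\<lambda>q. snd N q (fd f p v) (fd f p w)) (f p) (fd f p u)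
      + snd N (f p) (fd (\<lambda>q. fd f q v) p u) (fd f p w)
      + snd N (f p) (fd f p v) (fd (\<lambda>q. fd f q w) p u)"
proof -
  have "((\<lambda>q. snd N (f q) (fd f q v) (fd f q w)) has_derivative
      (\<lambda>u. fd (\<lambda>q. snd N q (fd f p v) (fd f p w)) (f p) (fd f p u)
      + snd N (f p) (fd (\<lambda>q. fd f q v) p u) (fd f p w)
      + snd N (f p) (fd f p v) (fd (\<lambda>q. fd f q w) p u))) (at p)"
    by (rule bilinear_field_has_derivative[where T = "fst N" and B = "snd N"
          and B' = "\<lambda>v w. fd (\<lambda>q. snd N q v w) (f p)"])
       (use p pseudo_riemannianD[OF N] image_in f_has_derivative fd_has_derivative
         in \<open>auto intro: differentiable_at_fd\<close>)
  then have "((\<lambda>q. snd M q v w) has_derivative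
      (\<lambda>u. fd (\<lambda>q. snd N q (fd f p v) (fd f p w)) (f p) (fd f p u)
      + snd N (f p) (fd (\<lambda>q. fd f q v) p u) (fd f p w)
      + snd N (f p) (fd f p v) (fd (\<lambda>q. fd f q w) p u))) (at p)"
    by (rule has_derivative_transform_within_open[OF _ pseudo_riemannianD(1)[OF M] p])
       (rule metric_preserved)
  then show ?thesis by (simp only: fd_eq)
qed

lemma second_derivative_sym:
  assumes "p \<in> fst M"
  shows "fd (\<lambda>q. fd f q v) p u = fd (\<lambda>q. fd f q u) p v"
  by (rule fd_symmetric[OF pseudo_riemannianD(1)[OF M] assms])
     (use assms in \<open>auto intro: smooth_on_differentiable[OF smooth] smooth_on_differentiable[OF smooth_on_fd[OF smooth]]\<close>)

text \<open>Compare the Koszul formula of \<open>M\<close> with the pullback of that of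
  \<open>N\<close>. Differentiating the metric produces six terms with second derivatives of
  \<open>f\<close>; by symmetry four of them cancel and the other two agree. This expresses the
  second derivatives of an isometry by its first ones.\<close>

lemma second_derivative:
  assumes p: "p \<in> fst M"
  shows "fd (\<lambda>q. fd f q v) p u = fd f p (\<Gamma> p u v) - \<Gamma>' (f p) (fd f p u) (fd f p v)"
proof -
  note fp = image_in[OF p]
  note bil = pseudo_riemannianD(2)[OF N fp]
  let ?D = "fd f p" and ?g = "snd N (f p)" and ?DD = "\<lambda>u v. fd (\<lambda>q. fd f q v) p u"
  obtain G where G: "\<And>x. ?D (G x) = x" by (rule fd_inverse[OF p]) blast
  note sym = pseudo_riemannianD(3)[OF N fp]
  \<comment> \<open>Only vectors \<open>?D w\<close> are tested; since \<open>?D\<close> is onto, by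
    \<open>G\<close>, these are all vectors.\<close>
  have *: "?g (?DD u v - (?D (\<Gamma> p u v) - \<Gamma>' (f p) (?D u) (?D v))) (?D w) = 0" for w
  proof -
    have "2 * ?g (?D (\<Gamma> p u v)) (?D w) = 2 * snd M p (\<Gamma> p u v) w"
      by (simp only: metric_preserved[OF p])
    also have "\<dots> = fd (\<lambda>q. snd M q v w) p u + fd (\<lambda>q. snd M q u w) p v - fd (\<lambda>q. snd M q u v) p w"
      by (rule levi_civitaD(4)[OF LC p])
    also have "\<dots> = 2 * ?g (\<Gamma>' (f p) (?D u) (?D v)) (?D w) + 2 * ?g (?DD u v) (?D w)"
      unfolding metric_derivative[OF p] levi_civitaD(4)[OF LC' fp]
      using second_derivative_sym[OF p, of u v] second_derivative_sym[OF p, of u w]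
        second_derivative_sym[OF p, of v w] sym[of "?D v" "?DD u w"] sym[of "?D u" "?DD v w"]
      by simp
    finally show ?thesis by (simp add: bilinear_lsub[OF bil])
  qed
  have "?g (?DD u v - (?D (\<Gamma> p u v) - \<Gamma>' (f p) (?D u) (?D v))) w = 0" for w
    using *[of "G w"] by (simp only: G)
  from pseudo_riemannianD(4)[OF N fp this] show ?thesis by simp
qed

lemma third_derivative:
  assumes p: "p \<in> fst M"
  shows "fd (\<lambda>q. fd (\<lambda>q. fd f q w) q v) p u =
     fd (\<lambda>q. fd f q (\<Gamma> p v w)) p u + fd f p (fd (\<lambda>q. \<Gamma> q v w) p u)
     - (fd (\<lambda>q. \<Gamma>' q (fd f p v) (fd f p w)) (f p) (fd f p u)
        + \<Gamma>' (f p) (fd (\<lambda>q. fd f q v) p u) (fd f p w)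
        + \<Gamma>' (f p) (fd f p v) (fd (\<lambda>q. fd f q w) p u))"
proof -
  note fp = image_in[OF p]
  have 1: "((\<lambda>q. \<Gamma>' (f q) (fd f q v) (fd f q w)) has_derivative
      (\<lambda>u. fd (\<lambda>q. \<Gamma>' q (fd f p v) (fd f p w)) (f p) (fd f p u)
        + \<Gamma>' (f p) (fd (\<lambda>q. fd f q v) p u) (fd f p w)
        + \<Gamma>' (f p) (fd f p v) (fd (\<lambda>q. fd f q w) p u))) (at p)"
    by (rule bilinear_field_has_derivative[where T = "fst N" and B = \<Gamma>'
          and B' = "\<lambda>v w. fd (\<lambda>q. \<Gamma>' q v w) (f p)"])
       (use p pseudo_riemannianD(1)[OF N] levi_civitaD[OF LC'] image_in f_has_derivative fd_has_derivative
         in \<open>auto intro: differentiable_at_fd\<close>)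
  \<comment> \<open>\<open>fd f q (\<Gamma> q v w)\<close> depends on \<open>q\<close> twice; the
    basis expansion separates the two dependences into a product.\<close>
  let ?E = "\<lambda>q x. \<Sum>i\<in>Basis. (x \<bullet> i) *\<^sub>R fd f q i"
  have E: "fd f q x = ?E q x" if "q \<in> fst M" for q x
  proof -
    interpret linear "fd f q" by (rule fd_linear[OF that])
    have "fd f q x = fd f q (\<Sum>i\<in>Basis. (x \<bullet> i) *\<^sub>R i)" by (simp only: euclidean_representation)
    also have "\<dots> = ?E q x" by (simp only: sum scale)
    finally show ?thesis .
  qed
  have G: "((\<lambda>q. \<Gamma> q v w) has_derivative fd (\<lambda>q. \<Gamma> q v w) p) (at p)"
    by (intro differentiable_at_fd levi_civitaD(3)[OF LC p])
  have D2: "fd (\<lambda>q. fd f q x) p u = (\<Sum>i\<in>Basis. (x \<bullet> i) *\<^sub>R fd (\<lambda>q. fd f q i) p u)" for x u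
  proof -
    have "((\<lambda>q. ?E q x) has_derivative
            (\<lambda>u. \<Sum>i\<in>Basis. (x \<bullet> i) *\<^sub>R fd (\<lambda>q. fd f q i) p u)) (at p)"
      by (intro has_derivative_sum has_derivative_scaleR_right fd_has_derivative p)
    then have "((\<lambda>q. fd f q x) has_derivative
            (\<lambda>u. \<Sum>i\<in>Basis. (x \<bullet> i) *\<^sub>R fd (\<lambda>q. fd f q i) p u)) (at p)"
      by (rule has_derivative_transform_within_open[OF _ pseudo_riemannianD(1)[OF M] p])
         (simp only: E[of _ x])
    then show ?thesis by (simp only: fd_eq)
  qed
  have "((\<lambda>q. ?E q (\<Gamma> q v w)) has_derivative
      (\<lambda>u. \<Sum>i\<in>Basis. (\<Gamma> p v w \<bullet> i) *\<^sub>R fd (\<lambda>q. fd f q i) p u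
           + (fd (\<lambda>q. \<Gamma> q v w) p u \<bullet> i) *\<^sub>R fd f p i)) (at p)"
    by (rule has_derivative_sum[OF has_derivative_scaleR[OF has_derivative_inner_left[OF G]
          fd_has_derivative[OF p]]])
  then have 2: "((\<lambda>q. ?E q (\<Gamma> q v w)) has_derivative
      (\<lambda>u. fd (\<lambda>q. fd f q (\<Gamma> p v w)) p u + fd f p (fd (\<lambda>q. \<Gamma> q v w) p u))) (at p)"
    by (simp only: sum.distrib D2[of "\<Gamma> p v w"] E[OF p, of "fd (\<lambda>q. \<Gamma> q v w) p u" for u])
  have "((\<lambda>q. fd (\<lambda>q. fd f q w) q v) has_derivative
     (\<lambda>u. fd (\<lambda>q. fd f q (\<Gamma> p v w)) p u + fd f p (fd (\<lambda>q. \<Gamma> q v w) p u)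
     - (fd (\<lambda>q. \<Gamma>' q (fd f p v) (fd f p w)) (f p) (fd f p u)
        + \<Gamma>' (f p) (fd (\<lambda>q. fd f q v) p u) (fd f p w)
        + \<Gamma>' (f p) (fd f p v) (fd (\<lambda>q. fd f q w) p u)))) (at p)"
    by (rule has_derivative_transform_within_open[OF has_derivative_diff[OF 2 1]
          pseudo_riemannianD(1)[OF M] p])
       (simp only: second_derivative E[of q "\<Gamma> q v w" for q])
  then show ?thesis by (simp only: fd_eq)
qed

text \<open>Third derivatives of \<open>f\<close> are symmetric in \<open>u\<close> and
  \<open>v\<close>, so antisymmetrising \<open>third_derivative\<close> removes them. Rewriting the
  remaining second derivatives by \<open>second_derivative\<close> leaves just the two
  curvatures.\<close>

lemma curvature_transform:
  assumes p: "p \<in> fst M"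
  shows "curvature \<Gamma>' (f p) (fd f p u) (fd f p v) (fd f p w) = fd f p (curvature \<Gamma> p u v w)"
proof -
  note fp = image_in[OF p]
  interpret l: linear "fd f p" by (rule fd_linear[OF p])
  have bil: "bilinear (\<Gamma>' (f p))" by (rule levi_civitaD(1)[OF LC' fp])
  have sw: "smooth_on (fst M) (\<lambda>q. fd f q w)" by (rule smooth_on_fd[OF smooth])
  have "fd (\<lambda>q. fd (\<lambda>q. fd f q w) q v) p u = fd (\<lambda>q. fd (\<lambda>q. fd f q w) q u) p v"
    by (rule fd_symmetric[OF pseudo_riemannianD(1)[OF M] p])
       (use p in \<open>auto intro: smooth_on_differentiable[OF sw] smooth_on_differentiable[OF smooth_on_fd[OF sw]]\<close>)
  moreover have "fd (\<lambda>q. fd f q v) p u = fd (\<lambda>q. fd f q u) p v"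
    by (rule second_derivative_sym[OF p])
  ultimately show ?thesis
    unfolding third_derivative[OF p] second_derivative[OF p, of w] second_derivative[OF p, of "\<Gamma> p v w"]
      second_derivative[OF p, of "\<Gamma> p u w"] curvature_def bilinear_rsub[OF bil] l.add l.diff
    by (simp add: algebra_simps)
qed

end

text \<open>The Ricci tensors correspond under \<open>fd f p\<close>; raising an index makes the
  operators \<open>A\<close> and \<open>A'\<close> conjugate, so their traces agree.\<close>

theorem scalar_curvature_isometry_invariant:
  fixes M N :: "'a::euclidean_space riemannian"
  assumes iso: "riemannian_isometry M N f" "pseudo_riemannian M" "pseudo_riemannian N"
    and p: "p \<in> fst M"
    and k: "has_scalar_curvature M p k" and k': "has_scalar_curvature N (f p) k'"
  shows "k = k'"
proof -
  obtain \<Gamma> A where A: "levi_civita M \<Gamma>" "linear A" "\<And>v w. snd M p (A v) w = ricci \<Gamma> p v w"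
    "operator_trace A = k" using k unfolding has_scalar_curvature_def by blast
  obtain \<Gamma>' A' where A': "levi_civita N \<Gamma>'" "\<And>v w. snd N (f p) (A' v) w = ricci \<Gamma>' (f p) v w"
    "operator_trace A' = k'" using k' unfolding has_scalar_curvature_def by blast
  interpret isometry_between M N f \<Gamma> \<Gamma>'
    using iso A(1) A'(1) by unfold_locales
  note fp = image_in[OF p]
  obtain G where G: "linear G" "\<And>x. G (fd f p x) = x" "\<And>x. fd f p (G x) = x"
    by (rule fd_inverse[OF p]) blast
  \<comment> \<open>Conjugating a trace requires a linear map. For the term where \<open>u\<close>
    is an argument of the differentiated \<open>\<Gamma>\<close>, linearity is carried through the
    derivative by a basis expansion.\<close>
  have lincurv: "linear (\<lambda>u. curvature \<Gamma> p u v w)" for v w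
  proof -
    have fdlin: "linear (fd (\<lambda>q. \<Gamma> q v w) p)" for v w
      using levi_civitaD(3)[OF A(1) p] by (rule linear_frechet_derivative)
    have expand: "fd (\<lambda>q. \<Gamma> q u w) p v = (\<Sum>i\<in>Basis. (u \<bullet> i) *\<^sub>R fd (\<lambda>q. \<Gamma> q i w) p v)" for u w v
    proof -
      have "((\<lambda>q. \<Sum>i\<in>Basis. (u \<bullet> i) *\<^sub>R \<Gamma> q i w) has_derivative
             (\<lambda>v. \<Sum>i\<in>Basis. (u \<bullet> i) *\<^sub>R fd (\<lambda>q. \<Gamma> q i w) p v)) (at p)"
        by (intro has_derivative_sum has_derivative_scaleR_right differentiable_at_fd levi_civitaD(3)[OF A(1) p])
      then have "((\<lambda>q. \<Gamma> q u w) has_derivative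
             (\<lambda>v. \<Sum>i\<in>Basis. (u \<bullet> i) *\<^sub>R fd (\<lambda>q. \<Gamma> q i w) p v)) (at p)"
      proof (rule has_derivative_transform_within_open[OF _ pseudo_riemannianD(1)[OF M] p])
        fix q assume q: "q \<in> fst M"
        interpret linear "\<lambda>u. \<Gamma> q u w" using levi_civitaD(1)[OF A(1) q] by (simp add: bilinear_def)
        have "\<Gamma> q u w = \<Gamma> q (\<Sum>i\<in>Basis. (u \<bullet> i) *\<^sub>R i) w" by (simp only: euclidean_representation)
        then show "(\<Sum>i\<in>Basis. (u \<bullet> i) *\<^sub>R \<Gamma> q i w) = \<Gamma> q u w" by (simp only: sum scale)
      qed
      then show ?thesis by (simp only: fd_eq)
    qed
    have "linear (\<lambda>u. fd (\<lambda>q. \<Gamma> q u w) p v)" for w v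
    proof (rule linearI)
      show "fd (\<lambda>q. \<Gamma> q (x + y) w) p v = fd (\<lambda>q. \<Gamma> q x w) p v + fd (\<lambda>q. \<Gamma> q y w) p v" for x y
        unfolding expand[of "x + y"] expand[of x] expand[of y]
        by (simp add: inner_add_left scaleR_add_left sum.distrib)
      show "fd (\<lambda>q. \<Gamma> q (c *\<^sub>R x) w) p v = c *\<^sub>R fd (\<lambda>q. \<Gamma> q x w) p v" for c x
        unfolding expand[of "c *\<^sub>R x"] expand[of x]
        by (simp add: scaleR_sum_right)
    qed
    with fdlin levi_civitaD(1)[OF A(1) p] show ?thesis
      unfolding curvature_def bilinear_def
      by (intro linear_compose_add linear_compose_sub linear_compose[unfolded o_def, of "\<lambda>u. \<Gamma> p u w"
            "\<Gamma> p v"]) auto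
  qed
  have "ricci \<Gamma>' (f p) v w = ricci \<Gamma> p (G v) (G w)" for v w
  proof -
    have "ricci \<Gamma>' (f p) v w = operator_trace (\<lambda>u. fd f p (curvature \<Gamma> p (G u) (G v) (G w)))"
      unfolding ricci_def curvature_transform[OF p, symmetric] G ..
    also have "\<dots> = ricci \<Gamma> p (G v) (G w)"
      unfolding ricci_def by (rule operator_trace_conjugate[OF lincurv fd_linear[OF p] G(1,2)])
    finally show ?thesis .
  qed
  then have eq: "snd N (f p) (A' v) w = snd N (f p) (fd f p (A (G v))) w" for v w
    using metric_preserved[OF p, of "A (G v)" "G w"] by (simp only: A(3) A'(2) G(3))
  have "A' v = fd f p (A (G v))" for v
  proof -
    have "snd N (f p) (A' v - fd f p (A (G v))) w = 0" for w
      using eq by (simp add: bilinear_lsub[OF pseudo_riemannianD(2)[OF N fp]])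
    from pseudo_riemannianD(4)[OF N fp this] show ?thesis by simp
  qed
  then have "A' = (\<lambda>v. fd f p (A (G v)))" by blast
  then show ?thesis
    using operator_trace_conjugate[OF A(2) fd_linear[OF p] G(1,2)] A(4) A'(3) by simp
qed

section \<open>Hessian metrics on tube domains\<close>

lemma operator_trace_add: "operator_trace (\<lambda>x. F x + G x) = operator_trace F + operator_trace G"
  by (simp add: operator_trace_def inner_add_left sum.distrib)

lemma operator_trace_diff: "operator_trace (\<lambda>x. F x - G x) = operator_trace F - operator_trace G"
  by (simp add: operator_trace_def inner_diff_left sum_subtractf)

lemma operator_trace_scaleR: "operator_trace (\<lambda>x. c *\<^sub>R F x) = c * operator_trace F"
  by (simp add: operator_trace_def sum_distrib_left)

lemma operator_trace_zero: "operator_trace (\<lambda>x. 0) = 0"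
  by (simp add: operator_trace_def)

lemma operator_trace_ident: "operator_trace (\<lambda>x::'a::euclidean_space. x) = DIM('a)"
  by (simp add: operator_trace_def)

lemma operator_trace_rank_one:
  assumes "linear \<alpha>"
  shows "operator_trace (\<lambda>x. \<alpha> x *\<^sub>R y) = \<alpha> y"
proof -
  interpret linear \<alpha> by fact
  have "\<alpha> y = \<alpha> (\<Sum>b\<in>Basis. (y \<bullet> b) *\<^sub>R b)" by (simp only: euclidean_representation)
  also have "\<dots> = operator_trace (\<lambda>x. \<alpha> x *\<^sub>R y)"
    by (simp add: sum scale operator_trace_def mult.commute)
  finally show ?thesis ..
qed

lemmas operator_trace_simps = operator_trace_add operator_trace_diff operator_trace_scaleR operator_trace_zero

lemma operator_trace_vec: "operator_trace (F :: real^'n \<Rightarrow> real^'n) = (\<Sum>i\<in>UNIV. F (axis i 1) $ i)"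
proof -
  have inj: "inj (\<lambda>i::'n. axis i (1::real))" by (auto simp: inj_def axis_eq_axis)
  have B: "(Basis :: (real^'n) set) = range (\<lambda>i. axis i 1)" by (auto simp: Basis_vec_def)
  show ?thesis
    unfolding operator_trace_def B by (simp add: sum.reindex[OF inj] inner_axis)
qed

section \<open>Splitting complex vectors into real and imaginary parts\<close>

definition Re_vec :: "complex^'n \<Rightarrow> real^'n" where
  "Re_vec z = (\<chi> \<mu>. Re (z $ \<mu>))"

definition complex_vec :: "real^'n \<Rightarrow> real^'n \<Rightarrow> complex^'n" where
  "complex_vec y x = (\<chi> i. Complex (y $ i) (x $ i))"

lemma Re_vec_complex_vec [simp]: "Re_vec (complex_vec y x) = y"
  and Im_vec_complex_vec [simp]: "Im_vec (complex_vec y x) = x"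
  by (simp_all add: Re_vec_def Im_vec_def complex_vec_def vec_eq_iff)

lemma linear_Re_vec: "linear (Re_vec :: complex^'n \<Rightarrow> _)"
  and linear_Im_vec: "linear (Im_vec :: complex^'n \<Rightarrow> _)"
  by (auto intro!: linearI simp: Re_vec_def Im_vec_def vec_eq_iff)

lemmas Re_vec_simps [simp] = linear_add[OF linear_Re_vec] linear_diff[OF linear_Re_vec]
  linear_cmul[OF linear_Re_vec] linear_0[OF linear_Re_vec]

lemmas Im_vec_simps [simp] = linear_add[OF linear_Im_vec] linear_diff[OF linear_Im_vec]
  linear_cmul[OF linear_Im_vec] linear_0[OF linear_Im_vec]

lemma complex_vec_arith:
  "complex_vec b a + complex_vec b' a' = complex_vec (b + b') (a + a')"
  "complex_vec b a - complex_vec b' a' = complex_vec (b - b') (a - a')"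
  "c *\<^sub>R complex_vec b a = complex_vec (c *\<^sub>R b) (c *\<^sub>R a)"
  by (simp_all add: complex_vec_def vec_eq_iff complex_eq_iff)

lemma Im_vec_has_derivative: "(Im_vec has_derivative Im_vec) (at z)"
  by (rule bounded_linear.has_derivative[OF _ has_derivative_ident])
     (simp add: linear_conv_bounded_linear[symmetric] linear_Im_vec)

lemma complex_vec_has_derivative:
  fixes f g :: "'a::real_normed_vector \<Rightarrow> real^'n"
  assumes f: "(f has_derivative f') (at p)" and g: "(g has_derivative g') (at p)"
  shows "((\<lambda>q. complex_vec (f q) (g q)) has_derivative (\<lambda>u. complex_vec (f' u) (g' u))) (at p)"
proof -
  have "linear (\<lambda>b::real^'n. complex_vec b 0)" "linear (\<lambda>a::real^'n. complex_vec 0 a)"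
    by (auto intro!: linearI simp: complex_vec_arith)
  then have "bounded_linear (\<lambda>b::real^'n. complex_vec b 0)" "bounded_linear (\<lambda>a::real^'n. complex_vec 0 a)"
    by (simp_all add: linear_conv_bounded_linear)
  from has_derivative_add[OF bounded_linear.has_derivative[OF this(1) f]
      bounded_linear.has_derivative[OF this(2) g]]
  show ?thesis by (simp add: complex_vec_arith)
qed

lemma open_Im_vec_vimage: "open D \<Longrightarrow> open {z. Im_vec z \<in> D}"
  unfolding vimage_def[symmetric]
  by (rule open_vimage)
     (auto simp: continuous_on_eq_continuous_at intro: has_derivative_continuous[OF Im_vec_has_derivative])

lemma axis_complex: "axis i 1 = complex_vec (axis i 1) 0" "axis i \<i> = complex_vec 0 (axis i 1)"
  by (simp_all add: complex_vec_def vec_eq_iff axis_def complex_eq_iff)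

lemma operator_trace_complex_vec:
  fixes L :: "complex^'n \<Rightarrow> complex^'n"
  shows "operator_trace L = operator_trace (\<lambda>e. Re_vec (L (complex_vec e 0)))
           + operator_trace (\<lambda>e. Im_vec (L (complex_vec 0 e)))"
proof -
  have 1: "inj (\<lambda>i::'n. axis i (1::complex))" and 2: "inj (\<lambda>i::'n. axis i \<i>)"
    by (auto simp: inj_def axis_eq_axis)
  have B: "(Basis :: (complex^'n) set) = range (\<lambda>i. axis i 1) \<union> range (\<lambda>i. axis i \<i>)"
    by (auto simp: Basis_vec_def Basis_complex_def)
  have "operator_trace L = (\<Sum>b\<in>range (\<lambda>i. axis i 1). L b \<bullet> b) + (\<Sum>b\<in>range (\<lambda>i. axis i \<i>). L b \<bullet> b)"
    unfolding operator_trace_def B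
    by (rule sum.union_disjoint) (auto simp: axis_eq_axis)
  also have "\<dots> = (\<Sum>i\<in>UNIV. Re (L (axis i 1) $ i)) + (\<Sum>i\<in>UNIV. Im (L (axis i \<i>) $ i))"
    by (simp add: sum.reindex[OF 1] sum.reindex[OF 2] inner_axis)
  finally show ?thesis
    by (simp only: operator_trace_vec Re_vec_def Im_vec_def vec_lambda_beta axis_complex)
qed

text \<open>\<open>T\<close> and \<open>Q\<close> are the first and second derivatives of the metric \<open>G\<close>, \<open>S\<close> is \<open>T\<close> with its last
  index raised, and \<open>\<Lambda>\<close> is the Hessian of \<open>log det G\<close>, whose gradient is the trace of \<open>S\<close> by
  Jacobi's formula.\<close>

locale hessian_tube =
  fixes D :: "(real^'n) set" and g :: "complex^'n \<Rightarrow> complex^'n \<Rightarrow> complex^'n \<Rightarrow> real"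
    and G :: "real^'n \<Rightarrow> real^'n \<Rightarrow> real^'n \<Rightarrow> real"
    and T :: "real^'n \<Rightarrow> real^'n \<Rightarrow> real^'n \<Rightarrow> real^'n \<Rightarrow> real"
    and Q :: "real^'n \<Rightarrow> real^'n \<Rightarrow> real^'n \<Rightarrow> real^'n \<Rightarrow> real^'n \<Rightarrow> real"
    and S :: "real^'n \<Rightarrow> real^'n \<Rightarrow> real^'n \<Rightarrow> real^'n"
    and \<Lambda> :: "real^'n \<Rightarrow> real^'n \<Rightarrow> real^'n \<Rightarrow> real"
  assumes open_D: "open D"
    and metric: "\<And>p u v. Im_vec p \<in> D \<Longrightarrow> g p u v =
        (G (Im_vec p) (Im_vec u) (Im_vec v) + G (Im_vec p) (Re_vec u) (Re_vec v)) / 2"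
    and bilinear_G: "x \<in> D \<Longrightarrow> bilinear (G x)"
    and sym_G: "x \<in> D \<Longrightarrow> G x u v = G x v u"
    and nondegenerate: "x \<in> D \<Longrightarrow> (\<And>v. G x u v = 0) \<Longrightarrow> u = 0"
    and G_derivative: "x \<in> D \<Longrightarrow> ((\<lambda>x. G x v w) has_derivative (\<lambda>u. T x u v w)) (at x)"
    and T_derivative: "x \<in> D \<Longrightarrow> ((\<lambda>x. T x u v w) has_derivative (\<lambda>c. Q x c u v w)) (at x)"
    and sym_T: "x \<in> D \<Longrightarrow> T x u v w = T x v u w"
    and sym_Q: "x \<in> D \<Longrightarrow> Q x c u v w = Q x u c v w"
    and bilinear_S: "x \<in> D \<Longrightarrow> bilinear (S x)"
    and S: "x \<in> D \<Longrightarrow> G x (S x u v) w = T x u v w"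
    and S_differentiable: "x \<in> D \<Longrightarrow> (\<lambda>x. S x u v) differentiable at x"
    and trace_S_derivative: "x \<in> D \<Longrightarrow>
        ((\<lambda>x. operator_trace (\<lambda>u. S x u v)) has_derivative (\<lambda>u. \<Lambda> x u v)) (at x)"
begin

abbreviation M :: "(complex^'n) riemannian" where "M \<equiv> ({z. Im_vec z \<in> D}, g)"

lemma G_unique:
  assumes "x \<in> D" "\<And>w. G x u w = G x v w"
  shows "u = v"
proof -
  have "G x (u - v) w = 0" for w using assms by (simp add: bilinear_lsub[OF bilinear_G])
  from nondegenerate[OF assms(1) this] show ?thesis by simp
qed

text \<open>With \<open>sym_T\<close>, which reflects that \<open>G\<close> is locally a Hessian,
  this makes \<open>T\<close> symmetric in all three arguments.\<close>

lemma sym_T':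
  assumes x: "x \<in> D" shows "T x u v w = T x u w v"
proof -
  have "((\<lambda>x. G x v w) has_derivative (\<lambda>u. T x u w v)) (at x)"
    by (rule has_derivative_transform_within_open[OF G_derivative[OF x] open_D x]) (rule sym_G)
  from has_derivative_unique[OF G_derivative[OF x] this] show ?thesis by (rule fun_cong)
qed

lemma sym_S:
  assumes x: "x \<in> D" shows "S x u v = S x v u"
  by (rule G_unique[OF x]) (simp only: S[OF x] sym_T[OF x, of u v])

definition dS :: "real^'n \<Rightarrow> real^'n \<Rightarrow> real^'n \<Rightarrow> real^'n \<Rightarrow> real^'n" where
  "dS x c u v = fd (\<lambda>x. S x u v) x c"

lemma S_has_derivative: "x \<in> D \<Longrightarrow> ((\<lambda>x. S x u v) has_derivative (\<lambda>c. dS x c u v)) (at x)"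
  unfolding dS_def by (rule differentiable_at_fd[OF S_differentiable])

lemma dS_zero:
  assumes "x \<in> D" shows "dS x c 0 v = 0"
proof -
  have "((\<lambda>x. S x 0 v) has_derivative (\<lambda>c. 0)) (at x)"
    by (rule has_derivative_transform_within_open[OF has_derivative_const open_D assms])
       (simp add: bilinear_lzero[OF bilinear_S])
  then show ?thesis by (simp add: dS_def fd_eq)
qed

text \<open>Differentiate \<open>G (S u v) w = T u v w\<close>: the result expresses that the part of the curvature
  of type \<open>(2,0)\<close> vanishes.\<close>

lemma dS_symmetric:
  assumes x: "x \<in> D"
  shows "dS x c u v + S x c (S x u v) = dS x u c v + S x u (S x c v)"
proof -
  have *: "G x (dS x c u v + S x c (S x u v)) w = Q x c u v w" for c u w
  proof -
    have "((\<lambda>x. G x (S x u v) w) has_derivative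
        (\<lambda>c. T x c (S x u v) w + G x (dS x c u v) w + G x (S x u v) 0)) (at x)"
      by (rule bilinear_field_has_derivative[where T = D and B = G and \<phi> = "\<lambda>x. x" and \<phi>' = "\<lambda>x. x"
            and B' = "\<lambda>v w u. T x u v w"])
         (use x open_D bilinear_G G_derivative S_has_derivative in auto)
    then have "((\<lambda>x. T x u v w) has_derivative
        (\<lambda>c. T x c (S x u v) w + G x (dS x c u v) w + G x (S x u v) 0)) (at x)"
      by (rule has_derivative_transform_within_open[OF _ open_D x]) (rule S)
    from has_derivative_unique[OF this T_derivative[OF x]] show ?thesis
      by (auto simp: fun_eq_iff S[OF x, symmetric] bilinear_ladd[OF bilinear_G[OF x]]
          bilinear_rzero[OF bilinear_G[OF x]] add.commute)
  qed
  show ?thesis by (rule G_unique[OF x]) (simp only: * sym_Q[OF x, of c])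
qed

text \<open>This is -i/2 times the complex bilinear extension of \<open>S\<close>: the Kaehler
  connection, metric inverse times derivative of the metric in z, where the derivative in z of a
  function of the imaginary part is -i/2 times its derivative in x.\<close>

definition \<Gamma> :: "complex^'n \<Rightarrow> complex^'n \<Rightarrow> complex^'n \<Rightarrow> complex^'n" where
  "\<Gamma> p u v = (let S = S (Im_vec p) in complex_vec
     ((1/2) *\<^sub>R (S (Re_vec u) (Im_vec v) + S (Im_vec u) (Re_vec v)))
     ((1/2) *\<^sub>R (S (Im_vec u) (Im_vec v) - S (Re_vec u) (Re_vec v))))"

lemma metric_derivative:
  assumes "Im_vec p \<in> D"
  shows "((\<lambda>q. g q u v) has_derivative (\<lambda>w. (T (Im_vec p) (Im_vec w) (Im_vec u) (Im_vec v)
           + T (Im_vec p) (Im_vec w) (Re_vec u) (Re_vec v)) / 2)) (at p)"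
proof -
  have "((\<lambda>q. (G (Im_vec q) (Im_vec u) (Im_vec v) + G (Im_vec q) (Re_vec u) (Re_vec v)) / 2)
     has_derivative (\<lambda>w. (T (Im_vec p) (Im_vec w) (Im_vec u) (Im_vec v)
           + T (Im_vec p) (Im_vec w) (Re_vec u) (Re_vec v)) / 2)) (at p)"
    by (intro bounded_linear.has_derivative[OF bounded_linear_divide] has_derivative_add
          has_derivative_compose[OF Im_vec_has_derivative G_derivative[OF assms]])
  then show ?thesis
    by (rule has_derivative_transform_within_open[OF _ open_Im_vec_vimage[OF open_D]])
       (use assms metric in auto)
qed

lemma pseudo_riemannian_M: "pseudo_riemannian M"
  unfolding pseudo_riemannian_def fst_conv snd_conv
proof (intro conjI ballI)
  show "open {z. Im_vec z \<in> D}" by (rule open_Im_vec_vimage[OF open_D])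
  fix p :: "complex^'n" assume "p \<in> {z. Im_vec z \<in> D}"
  then have p: "Im_vec p \<in> D" by simp
  note bil = bilinear_G[OF p]
  show "bilinear (g p)"
    unfolding bilinear_def
    by (intro conjI allI linearI)
       (simp_all add: metric[OF p] bilinear_ladd[OF bil] bilinear_radd[OF bil] bilinear_lmul[OF bil]
          bilinear_rmul[OF bil] add_divide_distrib distrib_left)
  have "g p u v = g p v u" for u v
    unfolding metric[OF p] sym_G[OF p, of "Im_vec u" "Im_vec v"] sym_G[OF p, of "Re_vec u" "Re_vec v"] ..
  then show "\<forall>u v. g p u v = g p v u" by blast
  show "\<forall>u. (\<forall>v. g p u v = 0) \<longrightarrow> u = 0"
  proof (intro allI impI)
    fix u assume u: "\<forall>v. g p u v = 0"
    have "G (Im_vec p) (Im_vec u) v = 0" for v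
      using spec[OF u, of "complex_vec 0 v"] by (simp add: metric[OF p] bilinear_rzero[OF bil])
    moreover have "G (Im_vec p) (Re_vec u) v = 0" for v
      using spec[OF u, of "complex_vec v 0"] by (simp add: metric[OF p] bilinear_rzero[OF bil])
    ultimately have "Im_vec u = 0" "Re_vec u = 0" using nondegenerate[OF p] by blast+
    then show "u = 0" by (simp add: Re_vec_def Im_vec_def vec_eq_iff complex_eq_iff)
  qed
  show "\<forall>u v. (\<lambda>q. g q u v) differentiable at p"
    using metric_derivative[OF p] differentiableI by blast
qed

lemma \<Gamma>_has_derivative:
  assumes "Im_vec p \<in> D"
  shows "((\<lambda>q. \<Gamma> q u v) has_derivative (\<lambda>w. let dS = dS (Im_vec p) (Im_vec w) in complex_vec
     ((1/2) *\<^sub>R (dS (Re_vec u) (Im_vec v) + dS (Im_vec u) (Re_vec v)))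
     ((1/2) *\<^sub>R (dS (Im_vec u) (Im_vec v) - dS (Re_vec u) (Re_vec v))))) (at p)"
  unfolding \<Gamma>_def Let_def
  by (intro complex_vec_has_derivative has_derivative_scaleR_right has_derivative_add has_derivative_diff
        has_derivative_compose[OF Im_vec_has_derivative S_has_derivative[OF assms]])

lemma levi_civita_\<Gamma>: "levi_civita M \<Gamma>"
  unfolding levi_civita_def fst_conv snd_conv
proof (intro conjI ballI)
  fix p :: "complex^'n" assume "p \<in> {z. Im_vec z \<in> D}"
  then have p: "Im_vec p \<in> D" by simp
  note bil = bilinear_S[OF p] and bilG = bilinear_G[OF p]
  show "bilinear (\<Gamma> p)"
    unfolding bilinear_def
    by (intro conjI allI linearI)
       (simp_all add: \<Gamma>_def Let_def complex_vec_arith bilinear_ladd[OF bil] bilinear_radd[OF bil]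
          bilinear_lmul[OF bil] bilinear_rmul[OF bil] algebra_simps)
  have "\<Gamma> p u v = \<Gamma> p v u" for u v
    unfolding \<Gamma>_def Let_def sym_S[OF p, of "Im_vec u" "Im_vec v"] sym_S[OF p, of "Re_vec u" "Re_vec v"]
      sym_S[OF p, of "Re_vec u" "Im_vec v"] sym_S[OF p, of "Im_vec u" "Re_vec v"]
    by (simp only: add.commute)
  then show "\<forall>u v. \<Gamma> p u v = \<Gamma> p v u" by blast
  show "\<forall>u v. (\<lambda>q. \<Gamma> q u v) differentiable at p"
    using \<Gamma>_has_derivative[OF p] differentiableI by blast
  show "\<forall>u v w. 2 * g p (\<Gamma> p u v) w =
           fd (\<lambda>q. g q v w) p u + fd (\<lambda>q. g q u w) p v - fd (\<lambda>q. g q u v) p w"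
  proof (intro allI)
    fix u v w
    define T' where "T' = T (Im_vec p)"
    have s: "T' a b c = T' b a c" "T' a b c = T' a c b" for a b c
      unfolding T'_def by (rule sym_T[OF p], rule sym_T'[OF p])
    show "2 * g p (\<Gamma> p u v) w =
           fd (\<lambda>q. g q v w) p u + fd (\<lambda>q. g q u w) p v - fd (\<lambda>q. g q u v) p w"
      unfolding fd_eq[OF metric_derivative[OF p]] metric[OF p]
      apply (simp add: \<Gamma>_def Let_def bilinear_ladd[OF bilG] bilinear_lsub[OF bilG] bilinear_lmul[OF bilG]
          S[OF p] T'_def[symmetric])
      \<comment> \<open>Both sides are sums of values of \<open>T'\<close>; these instances of its
        total symmetry bring matching terms to the same order of arguments.\<close>
      using s(1)[of "Im_vec u" "Im_vec v" "Im_vec w"] s(1)[of "Im_vec u" "Im_vec w" "Im_vec v"]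
        s(2)[of "Im_vec u" "Im_vec v" "Im_vec w"] s(2)[of "Im_vec w" "Im_vec u" "Im_vec v"]
        s(1)[of "Re_vec u" "Im_vec v" "Re_vec w"] s(2)[of "Re_vec u" "Re_vec v" "Im_vec w"]
        s(1)[of "Re_vec u" "Im_vec w" "Re_vec v"] s(2)[of "Im_vec v" "Im_vec u" "Im_vec w"]
        s(1)[of "Im_vec v" "Im_vec u" "Im_vec w"]
      by (simp add: field_simps)
  qed
qed

text \<open>After tracing, \<open>dS_symmetric\<close> trades derivatives of \<open>S\<close> along
  the trace index for \<open>\<Lambda>\<close> and quadratic terms, and the latter cancel all
  quadratic terms of the curvature.\<close>

lemma ricci_\<Gamma>:
  assumes p: "Im_vec p \<in> D"
  shows "ricci \<Gamma> p v w =
    - (\<Lambda> (Im_vec p) (Im_vec v) (Im_vec w) + \<Lambda> (Im_vec p) (Re_vec v) (Re_vec w)) / 2"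
proof -
  define x where "x = Im_vec p"
  have x: "x \<in> D" using p by (simp add: x_def)
  note bil = bilinear_S[OF x]
  let ?S = "S x" and ?dS = "dS x" and ?tr = operator_trace
  have fd\<Gamma>: "fd (\<lambda>q. \<Gamma> q u v) p w = complex_vec
     ((1/2) *\<^sub>R (?dS (Im_vec w) (Re_vec u) (Im_vec v) + ?dS (Im_vec w) (Im_vec u) (Re_vec v)))
     ((1/2) *\<^sub>R (?dS (Im_vec w) (Im_vec u) (Im_vec v) - ?dS (Im_vec w) (Re_vec u) (Re_vec v)))" for u v w
    by (simp only: fd_eq[OF \<Gamma>_has_derivative[OF p]] Let_def x_def)
  have \<Gamma>: "\<Gamma> p u v = complex_vec ((1/2) *\<^sub>R (?S (Re_vec u) (Im_vec v) + ?S (Im_vec u) (Re_vec v)))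
     ((1/2) *\<^sub>R (?S (Im_vec u) (Im_vec v) - ?S (Re_vec u) (Re_vec v)))" for u v
    by (simp only: \<Gamma>_def Let_def x_def)
  have dS0: "?dS 0 u v = 0" for u v
    using has_derivative_linear[OF S_has_derivative[OF x, of u v]] by (rule linear_0)
  note zero = bilinear_lzero[OF bil] bilinear_rzero[OF bil] dS_zero[OF x] dS0
  note lin = bilinear_rmul[OF bil] bilinear_lmul[OF bil] bilinear_rneg[OF bil] bilinear_radd[OF bil] bilinear_rsub[OF bil]
  define a b a' b' where ab: "a = Im_vec v" "b = Re_vec v" "a' = Im_vec w" "b' = Re_vec w"
  note D = ab[symmetric]
  \<comment> \<open>\<open>X\<close> is the imaginary part of \<open>\<Gamma> p v w\<close>.\<close>
  define X where "X = (1/2) *\<^sub>R (?S a a' - ?S b b')"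
  have re: "Re_vec (curvature \<Gamma> p (complex_vec e 0) v w) =
     (1/2) *\<^sub>R ?S e X - (1/2) *\<^sub>R ?dS a e a' - (1/4) *\<^sub>R (?S a (?S e a') - ?S b (?S e b'))" for e
    unfolding curvature_def fd\<Gamma> \<Gamma> by (simp add: zero lin D X_def algebra_simps)
  have im: "Im_vec (curvature \<Gamma> p (complex_vec 0 e) v w) =
     (1/2) *\<^sub>R (?dS e a a' - ?dS e b b') + (1/2) *\<^sub>R ?S e X - (1/2) *\<^sub>R ?dS a e a'
       - (1/4) *\<^sub>R (?S a (?S e a') - ?S b (?S e b'))" for e
    unfolding curvature_def fd\<Gamma> \<Gamma> by (simp add: zero lin D X_def algebra_simps)
  have \<Lambda>: "\<Lambda> x c u = ?tr (\<lambda>e. ?dS c e u)" for c u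
  proof -
    have "((\<lambda>x. ?tr (\<lambda>e. S x e u)) has_derivative (\<lambda>c. ?tr (\<lambda>e. ?dS c e u))) (at x)"
      unfolding operator_trace_def
      by (intro has_derivative_sum has_derivative_inner_left S_has_derivative x)
    from has_derivative_unique[OF trace_S_derivative[OF x] this] show ?thesis by (rule fun_cong)
  qed
  \<comment> \<open>Moves the trace index from the direction of differentiation into an argument of
    \<open>S\<close>, where the trace is \<open>\<Lambda>\<close>.\<close>
  have tr_dS: "?tr (\<lambda>e. ?dS e c u) = \<Lambda> x c u + ?tr (\<lambda>e. ?S c (?S e u)) - ?tr (\<lambda>e. ?S e (?S c u))" for c u
  proof -
    have "?dS e c u = ?dS c e u + ?S c (?S e u) - ?S e (?S c u)" for e
      using dS_symmetric[OF x, of e c u] by (simp add: algebra_simps)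
    then show ?thesis by (simp add: operator_trace_simps \<Lambda>)
  qed
  have trX: "?tr (\<lambda>e. ?S e X) = (1/2) * (?tr (\<lambda>e. ?S e (?S a a')) - ?tr (\<lambda>e. ?S e (?S b b')))"
    unfolding X_def lin operator_trace_simps ..
  show ?thesis
    unfolding ricci_def operator_trace_complex_vec re im operator_trace_simps tr_dS trX \<Lambda>[of a a', symmetric]
      x_def[symmetric] D
    by (simp add: field_simps)
qed

text \<open>The halves in the metric and in \<open>ricci_\<Gamma>\<close> cancel, so the Ricci
  operator is \<open>- B\<close> on the real and on the imaginary parts alike; two copies give the
  factor 2.\<close>

lemma scalar_curvature:
  assumes p: "Im_vec p \<in> D" and "linear B" and B: "\<And>u v. G (Im_vec p) (B u) v = \<Lambda> (Im_vec p) u v"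
  shows "has_scalar_curvature M p (- 2 * operator_trace B)"
  unfolding has_scalar_curvature_def
proof (intro exI conjI allI)
  interpret linear B by fact
  let ?A = "\<lambda>u. complex_vec (- B (Re_vec u)) (- B (Im_vec u))"
  note bil = bilinear_G[OF p]
  show "levi_civita M \<Gamma>" by (rule levi_civita_\<Gamma>)
  show "linear ?A" by (intro linearI) (simp_all add: add scale complex_vec_arith)
  show "snd M p (?A v) w = ricci \<Gamma> p v w" for v w
    by (simp add: metric[OF p] ricci_\<Gamma>[OF p] B bilinear_lneg[OF bil] add_divide_distrib)
  have "operator_trace (\<lambda>e. - B e) = - operator_trace B"
    by (simp add: operator_trace_def sum_negf)
  then show "operator_trace ?A = - 2 * operator_trace B"
    by (simp add: operator_trace_complex_vec)
qed

end

section \<open>Tube domains of cubic forms\<close>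

lemma real_basis_expansion: "(\<Sum>i\<in>UNIV. u $ i *\<^sub>R axis i 1) = (u :: real^'n)"
  using basis_expansion[of u] by (simp only: scalar_mult_eq_scaleR)

lemma bilinear_vec_expand:
  fixes B :: "real^'n \<Rightarrow> real^'m \<Rightarrow> real"
  assumes "bilinear B"
  shows "B u v = (\<Sum>i\<in>UNIV. \<Sum>j\<in>UNIV. u $ i * v $ j * B (axis i 1) (axis j 1))"
proof -
  have "B u v = B (\<Sum>i\<in>UNIV. u $ i *\<^sub>R axis i 1) (\<Sum>j\<in>UNIV. v $ j *\<^sub>R axis j 1)"
    by (simp only: real_basis_expansion)
  also have "\<dots> = (\<Sum>(i,j)\<in>UNIV\<times>UNIV. B (u $ i *\<^sub>R axis i 1) (v $ j *\<^sub>R axis j 1))"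
    by (rule bilinear_sum[OF assms])
  also have "\<dots> = (\<Sum>i\<in>UNIV. \<Sum>j\<in>UNIV. u $ i * v $ j * B (axis i 1) (axis j 1))"
    by (simp add: sum.cartesian_product bilinear_lmul[OF assms] bilinear_rmul[OF assms] mult_ac)
  finally show ?thesis .
qed

definition covector :: "(real^'n \<Rightarrow> real) \<Rightarrow> real^'n" where
  "covector \<alpha> = (\<chi> j. \<alpha> (axis j 1))"

lemma covector_inner:
  assumes "linear \<alpha>"
  shows "covector \<alpha> \<bullet> w = \<alpha> w"
proof -
  interpret linear \<alpha> by fact
  have "\<alpha> w = \<alpha> (\<Sum>j\<in>UNIV. w $ j *\<^sub>R axis j 1)"
    by (simp only: real_basis_expansion)
  also have "\<dots> = covector \<alpha> \<bullet> w" by (simp add: sum scale covector_def inner_vec_def mult.commute)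
  finally show ?thesis ..
qed

text \<open>\<open>H x\<close> is the Hessian at \<open>x\<close> of the cubic form \<open>h x = H x x x / 6\<close>; \<open>d\<close> and \<open>N\<close> stand for its determinant
  and adjugate.\<close>

locale cubic_form =
  fixes D :: "(real^'n) set" and H :: "real^'n \<Rightarrow> real^'n \<Rightarrow> real^'n \<Rightarrow> real"
    and N :: "real^'n \<Rightarrow> real^'n \<Rightarrow> real^'n"
    and d :: "real^'n \<Rightarrow> real" and dd :: "real^'n \<Rightarrow> real^'n \<Rightarrow> real"
    and ddd :: "real^'n \<Rightarrow> real^'n \<Rightarrow> real^'n \<Rightarrow> real"
  assumes open_D: "open D"
    and bilinear_H: "bilinear (H x)"
    and H_commute: "H x u v = H x v u"
    and H_left_commute: "H x u v = H u x v"
    and H_pos: "x \<in> D \<Longrightarrow> H x x x > 0"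
    and d_nonzero: "x \<in> D \<Longrightarrow> d x \<noteq> 0"
    and linear_N: "linear (N x)"
    and N_differentiable: "(\<lambda>x. N x \<alpha>) differentiable at x"
    and d_derivative: "(d has_derivative dd x) (at x)"
    and dd_derivative: "((\<lambda>x. dd x v) has_derivative (\<lambda>u. ddd x u v)) (at x)"
    and bilinear_ddd: "bilinear (ddd x)"
    and H_N: "H x (N x \<alpha>) w = d x * (\<alpha> \<bullet> w)"
    and trace_N: "operator_trace (\<lambda>e. N x (covector (H e v))) = dd x v"
begin

definition h :: "real^'n \<Rightarrow> real" where "h x = H x x x / 6"

text \<open>\<open>\<ll>\<close>, \<open>\<eta>\<close>, \<open>\<kappa>\<close> are the derivatives of \<open>h\<close> divided by \<open>h\<close>. In these terms \<open>- \<partial>\<^sup>2 log h\<close> and its derivatives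
  are polynomial.\<close>

definition \<ll> :: "real^'n \<Rightarrow> real^'n \<Rightarrow> real" where "\<ll> x v = H x x v / (2 * h x)"
definition \<eta> :: "real^'n \<Rightarrow> real^'n \<Rightarrow> real^'n \<Rightarrow> real" where "\<eta> x u v = H x u v / h x"
definition \<kappa> :: "real^'n \<Rightarrow> real^'n \<Rightarrow> real^'n \<Rightarrow> real^'n \<Rightarrow> real" where "\<kappa> x u v w = H u v w / h x"

definition G :: "real^'n \<Rightarrow> real^'n \<Rightarrow> real^'n \<Rightarrow> real" where
  "G x u v = \<ll> x u * \<ll> x v - \<eta> x u v"

definition T :: "real^'n \<Rightarrow> real^'n \<Rightarrow> real^'n \<Rightarrow> real^'n \<Rightarrow> real" where
  "T x u v w = \<eta> x u v * \<ll> x w + \<eta> x u w * \<ll> x v + \<eta> x v w * \<ll> x u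
     - 2 * (\<ll> x u * \<ll> x v * \<ll> x w) - \<kappa> x u v w"

definition Q :: "real^'n \<Rightarrow> real^'n \<Rightarrow> real^'n \<Rightarrow> real^'n \<Rightarrow> real^'n \<Rightarrow> real" where
  "Q x c u v w =
     (let \<ll> = \<ll> x; \<eta> = \<eta> x; \<kappa> = \<kappa> x; d\<ll> = (\<lambda>v. \<eta> c v - \<ll> c * \<ll> v); d\<eta> = (\<lambda>v w. \<kappa> c v w - \<eta> v w * \<ll> c) in
      d\<eta> u v * \<ll> w + \<eta> u v * d\<ll> w + (d\<eta> u w * \<ll> v + \<eta> u w * d\<ll> v) + (d\<eta> v w * \<ll> u + \<eta> v w * d\<ll> u)
      - 2 * ((d\<ll> u * \<ll> v + \<ll> u * d\<ll> v) * \<ll> w + \<ll> u * \<ll> v * d\<ll> w) + \<kappa> u v w * \<ll> c)"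

text \<open>\<open>G_inv\<close> applied to the covector \<open>T x u v\<close>, multiplied out:
  \<open>G_inv\<close> takes \<open>\<ll> x\<close> to \<open>x\<close> and
  \<open>\<eta> x u\<close> to \<open>\<ll> x u *\<^sub>R x - u\<close>.\<close>

definition S :: "real^'n \<Rightarrow> real^'n \<Rightarrow> real^'n \<Rightarrow> real^'n" where
  "S x u v = (1 / d x) *\<^sub>R N x (covector (H u v)) - \<ll> x v *\<^sub>R u - \<ll> x u *\<^sub>R v + (\<eta> x u v / 2) *\<^sub>R x"

text \<open>The Hessian of log |d|.\<close>

definition \<theta> :: "real^'n \<Rightarrow> real^'n \<Rightarrow> real^'n \<Rightarrow> real" where
  "\<theta> x u v = ddd x u v / d x - dd x u * dd x v / (d x)\<^sup>2"

text \<open>The Hessian of log (|d| / h^n), since that of - log h is \<open>G\<close>.\<close>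

definition \<Lambda> :: "real^'n \<Rightarrow> real^'n \<Rightarrow> real^'n \<Rightarrow> real" where
  "\<Lambda> x u v = \<theta> x u v + CARD('n) * G x u v"

text \<open>The Sherman-Morrison inverse of -H/h plus the square of \<open>\<ll>\<close>. By Euler,
  H inverse sends \<open>\<ll>\<close> to x/(2h) and \<open>\<ll> x x\<close> is 3, so the
  denominator 1 - 3/2 yields the coefficient 1/2.\<close>

definition G_inv :: "real^'n \<Rightarrow> real^'n \<Rightarrow> real^'n" where
  "G_inv x \<alpha> = - (h x / d x) *\<^sub>R N x \<alpha> + ((\<alpha> \<bullet> x) / 2) *\<^sub>R x"

lemmas H_bil = bilinear_ladd[OF bilinear_H] bilinear_radd[OF bilinear_H] bilinear_lmul[OF bilinear_H]
  bilinear_rmul[OF bilinear_H] bilinear_lsub[OF bilinear_H] bilinear_rsub[OF bilinear_H]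

lemma H_lin: "H (x + y) u v = H x u v + H y u v" "H (c *\<^sub>R x) u v = c * H x u v"
  by (simp_all add: H_left_commute[of "x + y" u v] H_left_commute[of "c *\<^sub>R x" u v]
      H_left_commute[of x u v] H_left_commute[of y u v] H_bil)

lemma linear_H: "linear (H x u)" and linear_H1: "linear (\<lambda>x. H x u v)" and linear_dd: "linear (dd x)"
  using bilinear_H[of x] has_derivative_linear[OF d_derivative]
  by (auto simp: bilinear_def H_lin intro: linearI)

lemma covector_H:
  "covector (H (x + y) v) = covector (H x v) + covector (H y v)"
  "covector (H v (x + y)) = covector (H v x) + covector (H v y)"
  "covector (H (c *\<^sub>R x) v) = c *\<^sub>R covector (H x v)"
  "covector (H v (c *\<^sub>R x)) = c *\<^sub>R covector (H v x)"
  by (simp_all add: covector_def vec_eq_iff H_bil H_lin)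

lemma h_pos: "x \<in> D \<Longrightarrow> h x > 0"
  by (simp add: h_def H_pos)

lemma H_derivative: "((\<lambda>x. H x u v) has_derivative (\<lambda>c. H c u v)) (at x)"
  by (rule bounded_linear.has_derivative[OF _ has_derivative_ident])
     (simp add: linear_conv_bounded_linear[symmetric] linear_H1)

lemma H2_derivative: "((\<lambda>x. H x x v) has_derivative (\<lambda>c. 2 * H x c v)) (at x)"
proof -
  have "((\<lambda>x. H x x v) has_derivative (\<lambda>c. H c x v + H x c v + H x x 0)) (at x)"
    by (rule bilinear_field_has_derivative[where T = UNIV and B = H and \<phi> = "\<lambda>x. x" and \<phi>' = "\<lambda>x. x"
            and B' = "\<lambda>v w u. H u v w" and a' = "\<lambda>x. x" and b' = "\<lambda>x. 0" and b = "\<lambda>x. v" and a = "\<lambda>x. x"])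
       (auto simp: bilinear_H H_derivative)
  then show ?thesis by (simp add: bilinear_rzero[OF bilinear_H] H_left_commute[of _ x])
qed

lemma h_derivative: "(h has_derivative (\<lambda>c. H x x c / 2)) (at x)"
proof -
  have "((\<lambda>x. H x x x) has_derivative (\<lambda>c. H c x x + H x c x + H x x c)) (at x)"
    by (rule bilinear_field_has_derivative[where T = UNIV and B = H and \<phi> = "\<lambda>x. x" and \<phi>' = "\<lambda>x. x"
            and B' = "\<lambda>v w u. H u v w" and a' = "\<lambda>x. x" and b' = "\<lambda>x. x" and b = "\<lambda>x. x" and a = "\<lambda>x. x"])
       (auto simp: bilinear_H H_derivative)
  also have "(\<lambda>c. H c x x + H x c x + H x x c) = (\<lambda>c. 3 * H x x c)"
    using H_left_commute[of _ x x] H_commute[of x _ x] by (auto simp: fun_eq_iff)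
  finally have "((\<lambda>x. H x x x / 6) has_derivative (\<lambda>c. 3 * H x x c / 6)) (at x)"
    by (rule bounded_linear.has_derivative[OF bounded_linear_divide])
  then show ?thesis by (simp add: h_def[abs_def])
qed

section \<open>The Hessian metric at a point of the cone\<close>

context
  fixes x assumes x: "x \<in> D"
begin

lemma h_nonzero: "h x \<noteq> 0" using h_pos[OF x] by simp

lemma \<eta>_derivative: "((\<lambda>x. \<eta> x u v) has_derivative (\<lambda>c. \<kappa> x c u v - \<eta> x u v * \<ll> x c)) (at x)"
  unfolding \<eta>_def \<kappa>_def \<ll>_def
  by (rule has_derivative_eq_rhs[OF has_derivative_divide'[OF H_derivative h_derivative h_nonzero]])
     (use h_nonzero in \<open>auto simp: fun_eq_iff field_simps power2_eq_square\<close>)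

lemma \<ll>_derivative: "((\<lambda>x. \<ll> x v) has_derivative (\<lambda>c. \<eta> x c v - \<ll> x c * \<ll> x v)) (at x)"
proof -
  have "((\<lambda>x. H x x v / h x / 2) has_derivative (\<lambda>c. \<eta> x c v - \<ll> x c * \<ll> x v)) (at x)"
    unfolding \<eta>_def \<ll>_def
    by (rule has_derivative_eq_rhs[OF bounded_linear.has_derivative[OF bounded_linear_divide
           has_derivative_divide'[OF H2_derivative h_derivative h_nonzero]]])
       (use h_nonzero in \<open>auto simp: fun_eq_iff field_simps power2_eq_square\<close>)
  then show ?thesis by (simp add: \<ll>_def[abs_def] mult.commute)
qed

lemma \<kappa>_derivative: "((\<lambda>x. \<kappa> x u v w) has_derivative (\<lambda>c. - (\<kappa> x u v w * \<ll> x c))) (at x)"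
  unfolding \<kappa>_def \<ll>_def
  by (rule has_derivative_eq_rhs[OF has_derivative_divide'[OF has_derivative_const h_derivative h_nonzero]])
     (use h_nonzero in \<open>auto simp: fun_eq_iff field_simps power2_eq_square\<close>)

lemma G_derivative: "((\<lambda>x. G x v w) has_derivative (\<lambda>u. T x u v w)) (at x)"
  unfolding G_def
  by (rule has_derivative_eq_rhs, (rule derivative_intros \<ll>_derivative \<eta>_derivative)+)
     (simp add: T_def fun_eq_iff algebra_simps)

lemma T_derivative: "((\<lambda>x. T x u v w) has_derivative (\<lambda>c. Q x c u v w)) (at x)"
  unfolding T_def
  by (rule has_derivative_eq_rhs, (rule derivative_intros \<ll>_derivative \<eta>_derivative \<kappa>_derivative)+)
     (simp add: Q_def Let_def fun_eq_iff algebra_simps)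

lemma \<eta>_commute: "\<eta> x u v = \<eta> x v u"
  by (simp add: \<eta>_def H_commute[of x u v])

lemma \<kappa>_commute: "\<kappa> x u v w = \<kappa> x v u w" "\<kappa> x u v w = \<kappa> x u w v"
  unfolding \<kappa>_def by (simp only: H_left_commute[of u v w], simp only: H_commute[of u v w])

lemma sym_T: "T x u v w = T x v u w"
  unfolding T_def \<eta>_commute[of v u] \<kappa>_commute(1)[of v u] by (simp add: algebra_simps)

lemma sym_Q: "Q x c u v w = Q x u c v w"
  unfolding Q_def Let_def \<eta>_commute[of u c] \<kappa>_commute(1)[of u c]
  by (simp add: algebra_simps)

lemma \<eta>_linear: "\<eta> x (a + b) w = \<eta> x a w + \<eta> x b w" "\<eta> x (a - b) w = \<eta> x a w - \<eta> x b w"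
  "\<eta> x (c *\<^sub>R a) w = c * \<eta> x a w" "\<eta> x w (a + b) = \<eta> x w a + \<eta> x w b" "\<eta> x w (c *\<^sub>R a) = c * \<eta> x w a"
  by (simp_all add: \<eta>_def H_bil add_divide_distrib diff_divide_distrib)

lemma \<ll>_linear: "\<ll> x (a + b) = \<ll> x a + \<ll> x b" "\<ll> x (a - b) = \<ll> x a - \<ll> x b" "\<ll> x (c *\<^sub>R a) = c * \<ll> x a"
  by (simp_all add: \<ll>_def H_bil add_divide_distrib diff_divide_distrib)

lemma bilinear_G: "bilinear (G x)"
  unfolding bilinear_def
  by (intro conjI allI linearI) (simp_all add: G_def \<eta>_linear \<ll>_linear algebra_simps)

lemma sym_G: "G x u v = G x v u"
  by (simp add: G_def \<eta>_commute[of u v])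

text \<open>Homogeneity of degree three: \<open>\<ll> x x = 3\<close> and
  \<open>\<eta> x x w = 2 * \<ll> x w\<close>.\<close>

lemma G_euler: "G x x w = \<ll> x w"
  using h_nonzero by (simp add: G_def \<ll>_def \<eta>_def) (simp add: h_def field_simps)

lemma \<ll>_N: "\<ll> x (N x \<alpha>) = d x * (\<alpha> \<bullet> x) / (2 * h x)"
  by (simp add: \<ll>_def H_commute[of x x] H_N)

lemma G_N: "G x (N x \<alpha>) w = d x / h x * ((\<alpha> \<bullet> x) / 2 * \<ll> x w - \<alpha> \<bullet> w)"
  using h_nonzero by (simp add: G_def \<ll>_N \<eta>_def H_N field_simps)

lemma G_G_inv: "G x (G_inv x \<alpha>) w = \<alpha> \<bullet> w"
  using h_nonzero d_nonzero[OF x]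
  by (simp add: G_inv_def bilinear_ladd[OF bilinear_G] bilinear_lmul[OF bilinear_G] bilinear_lsub[OF bilinear_G]
        G_N G_euler)

lemma nondegenerate: "(\<And>v. G x u v = 0) \<Longrightarrow> u = 0"
  \<comment> \<open>Pairing \<open>u\<close> with \<open>G_inv x u\<close> gives
    \<open>u \<bullet> u\<close>.\<close>
  using sym_G[of "G_inv x u" u] by (simp add: G_G_inv)

lemma G_S: "G x (S x u v) w = T x u v w"
proof -
  have "covector (H u v) \<bullet> x = H x u v"
    by (simp add: covector_inner[OF linear_H] H_commute[of u v x] H_left_commute[of u x v])
  then show ?thesis
    using h_nonzero d_nonzero[OF x]
    by (simp add: S_def T_def bilinear_ladd[OF bilinear_G] bilinear_lmul[OF bilinear_G] bilinear_lsub[OF bilinear_G]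
        G_N G_euler covector_inner[OF linear_H])
       (simp add: G_def \<eta>_def \<kappa>_def field_simps)
qed

lemma bilinear_S: "bilinear (S x)"
  unfolding bilinear_def
  by (intro conjI allI linearI)
     (simp_all add: S_def \<eta>_linear \<ll>_linear covector_H linear_add[OF linear_N]
        linear_cmul[OF linear_N] algebra_simps add_divide_distrib)

lemma S_differentiable: "(\<lambda>x. S x u v) differentiable at x"
proof -
  obtain N' where N': "((\<lambda>x. N x (covector (H u v))) has_derivative N') (at x)"
    using N_differentiable differentiable_def by blast
  show ?thesis
    unfolding S_def differentiable_def
    by (rule exI, (rule has_derivative_ident derivative_intros \<ll>_derivative \<eta>_derivative d_derivative N' d_nonzero[OF x]
        | rule zero_neq_numeral[symmetric])+)
qed

text \<open>\<open>trace_N\<close> is Jacobi's formula for \<open>d\<close>. The rank one terms with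
  \<open>v\<close> and with \<open>x\<close> have traces of opposite sign and equal size, so what
  remains is the derivative of log (|d| / h^n).\<close>

lemma trace_S: "operator_trace (\<lambda>u. S x u v) = dd x v / d x - CARD('n) * \<ll> x v"
proof -
  have "operator_trace (\<lambda>u. \<ll> x u *\<^sub>R v) = \<ll> x v"
    by (rule operator_trace_rank_one) (auto intro: linearI simp: \<ll>_linear)
  moreover have "operator_trace (\<lambda>u. (\<eta> x u v / 2) *\<^sub>R x) = \<eta> x x v / 2"
    by (rule operator_trace_rank_one) (auto intro: linearI simp: \<eta>_linear add_divide_distrib)
  moreover have "\<eta> x x v / 2 = \<ll> x v" by (simp add: \<eta>_def \<ll>_def)
  ultimately show ?thesis
    by (simp add: S_def operator_trace_simps trace_N operator_trace_ident)
qed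

lemma \<Lambda>_derivative: "((\<lambda>x. dd x v / d x - CARD('n) * \<ll> x v) has_derivative (\<lambda>u. \<Lambda> x u v)) (at x)"
  by (rule has_derivative_eq_rhs, (rule derivative_intros \<ll>_derivative d_derivative dd_derivative d_nonzero[OF x])+)
     (use d_nonzero[OF x] in \<open>auto simp: fun_eq_iff \<Lambda>_def \<theta>_def G_def field_simps power2_eq_square\<close>)

lemma bilinear_\<theta>: "bilinear (\<theta> x)"
  unfolding bilinear_def
  by (intro conjI allI linearI)
     (simp_all add: \<theta>_def bilinear_ladd[OF bilinear_ddd] bilinear_radd[OF bilinear_ddd] bilinear_lmul[OF bilinear_ddd]
       bilinear_rmul[OF bilinear_ddd] linear_add[OF linear_dd] linear_cmul[OF linear_dd]
       algebra_simps add_divide_distrib diff_divide_distrib)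

lemma \<theta>_bil: "\<theta> x (a + b) w = \<theta> x a w + \<theta> x b w" "\<theta> x (c *\<^sub>R a) w = c * \<theta> x a w" "linear (\<theta> x a)"
  using bilinear_\<theta> bilinear_ladd[OF bilinear_\<theta>] bilinear_lmul[OF bilinear_\<theta>]
  by (auto simp: bilinear_def)

lemma covector_\<theta>:
  "covector (\<theta> x (u + v)) = covector (\<theta> x u) + covector (\<theta> x v)"
  "covector (\<theta> x (c *\<^sub>R u)) = c *\<^sub>R covector (\<theta> x u)"
  by (simp_all add: covector_def vec_eq_iff \<theta>_bil)

definition ricci_form :: "real^'n \<Rightarrow> real^'n" where
  "ricci_form u = CARD('n) *\<^sub>R u + G_inv x (covector (\<theta> x u))"

lemma linear_ricci_form: "linear ricci_form"
  by (intro linearI)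
     (simp_all add: ricci_form_def G_inv_def covector_\<theta> linear_add[OF linear_N]
        linear_cmul[OF linear_N] inner_add_left algebra_simps add_divide_distrib)

lemma G_ricci_form: "G x (ricci_form u) v = \<Lambda> x u v"
  by (simp add: ricci_form_def \<Lambda>_def bilinear_ladd[OF bilinear_G] bilinear_lmul[OF bilinear_G] G_G_inv
        covector_inner[OF \<theta>_bil(3)])

lemma trace_ricci_form:
  "operator_trace ricci_form = (CARD('n))\<^sup>2 - h x / d x * operator_trace (\<lambda>e. N x (covector (\<theta> x e))) + \<theta> x x x / 2"
proof -
  have "operator_trace (\<lambda>u. (\<theta> x u x / 2) *\<^sub>R x) = \<theta> x x x / 2"
    by (rule operator_trace_rank_one) (auto intro: linearI simp: \<theta>_bil add_divide_distrib)
  then show ?thesis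
    unfolding ricci_form_def[abs_def] G_inv_def covector_inner[OF \<theta>_bil(3)] operator_trace_simps
    by (simp add: operator_trace_ident power2_eq_square)
qed

end

section \<open>The r-map metric as a Hessian metric\<close>

lemma kaehler_potential_derivative:
  assumes "Im_vec z \<in> D"
  shows "(kaehler_potential h has_derivative (\<lambda>u. - of_real (\<ll> (Im_vec z) (Im_vec u)))) (at z)"
proof -
  have "((\<lambda>z. - ln (h (Im_vec z))) has_derivative (\<lambda>u. - (\<ll> (Im_vec z) (Im_vec u)))) (at z)"
    by (rule has_derivative_eq_rhs, (rule derivative_intros has_derivative_compose[OF Im_vec_has_derivative h_derivative]
          h_pos[OF assms])+)
       (use h_pos[OF assms] in \<open>auto simp: fun_eq_iff \<ll>_def field_simps\<close>)
  from has_derivative_of_real[OF this] show ?thesis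
    by (simp add: kaehler_potential_def[abs_def])
qed

lemma d_zbar_kaehler_potential:
  assumes "Im_vec z \<in> D"
  shows "d_zbar \<nu> (kaehler_potential h) z = - \<i> * of_real (\<ll> (Im_vec z) (axis \<nu> 1)) / 2"
  unfolding d_zbar_def fd_eq[OF kaehler_potential_derivative[OF assms]]
  by (simp add: axis_complex \<ll>_def H_bil bilinear_rzero[OF bilinear_H])

text \<open>On functions of the imaginary part, \<open>d_zbar\<close> is i/2 and \<open>d_z\<close>
  is -i/2 times the real partial derivative.\<close>

lemma d_z_d_zbar_kaehler_potential:
  assumes z: "Im_vec z \<in> D"
  shows "d_z \<mu> (d_zbar \<nu> (kaehler_potential h)) z = of_real (G (Im_vec z) (axis \<mu> 1) (axis \<nu> 1)) / 4"
proof -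
  have "((\<lambda>z. - \<i> * of_real (\<ll> (Im_vec z) (axis \<nu> 1)) / 2) has_derivative
      (\<lambda>u. \<i> * of_real (G (Im_vec z) (Im_vec u) (axis \<nu> 1)) / 2)) (at z)"
    by (rule has_derivative_eq_rhs, (rule derivative_intros
          has_derivative_of_real[OF has_derivative_compose[OF Im_vec_has_derivative \<ll>_derivative[OF z]]])+)
       (simp_all add: fun_eq_iff G_def algebra_simps)
  then have "(d_zbar \<nu> (kaehler_potential h) has_derivative
      (\<lambda>u. \<i> * of_real (G (Im_vec z) (Im_vec u) (axis \<nu> 1)) / 2)) (at z)"
    by (rule has_derivative_transform_within_open[OF _ open_Im_vec_vimage[OF open_D]])
       (use z d_zbar_kaehler_potential in auto)
  then show ?thesis
    by (simp add: d_z_def fd_eq axis_complex bilinear_lzero[OF bilinear_G[OF z]])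
qed

text \<open>The coefficients \<open>G\<close>/4 are real, so only the real part of
  \<open>u $ \<mu> * cnj (v $ \<nu>)\<close> counts; it separates real from imaginary components.
  Together with the prefactor 2 this leaves \<open>G\<close>/2.\<close>

lemma r_map_metric_eq:
  assumes z: "Im_vec z \<in> D"
  shows "r_map_metric h z u v = (G (Im_vec z) (Im_vec u) (Im_vec v) + G (Im_vec z) (Re_vec u) (Re_vec v)) / 2"
  unfolding r_map_metric_def d_z_d_zbar_kaehler_potential[OF z]
    bilinear_vec_expand[OF bilinear_G[OF z], of "Im_vec u"] bilinear_vec_expand[OF bilinear_G[OF z], of "Re_vec u"]
    sum.distrib[symmetric]
  by (simp add: sum_distrib_left sum_divide_distrib Im_vec_def Re_vec_def)
     (intro sum.cong refl, simp add: algebra_simps)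

sublocale hessian_tube D "r_map_metric h" G T Q S \<Lambda>
proof
  show "((\<lambda>x. operator_trace (\<lambda>u. S x u v)) has_derivative (\<lambda>u. \<Lambda> x u v)) (at x)"
    if "x \<in> D" for x v
    by (rule has_derivative_transform_within_open[OF \<Lambda>_derivative[OF that] open_D that]) (simp add: trace_S)
qed (fact open_D r_map_metric_eq bilinear_G sym_G nondegenerate G_derivative T_derivative sym_T sym_Q
       bilinear_S G_S S_differentiable)+

theorem scalar_curvature_r_map:
  assumes "Im_vec p \<in> D"
  shows "has_scalar_curvature ({z. Im_vec z \<in> D}, r_map_metric h) p (let x = Im_vec p in
     2 * (h x / d x) * operator_trace (\<lambda>e. N x (covector (\<theta> x e))) - \<theta> x x x - 2 * (CARD('n))\<^sup>2)"
  using scalar_curvature[OF assms linear_ricci_form[OF assms] G_ricci_form[OF assms]]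
  by (simp add: trace_ricci_form[OF assms] Let_def algebra_simps)

end

section \<open>The five surfaces\<close>

fun hessian_det :: "surface_label \<Rightarrow> real^3 \<Rightarrow> real" where
  "hessian_det Surf_a p = 2 * p$1 * p$2 * p$3"
| "hessian_det Surf_b p = 8 * (p$1)^3"
| "hessian_det Surf_c p = 2 * p$1 * p$2 * p$3 - 6 * (p$1)^3"
| "hessian_det Surf_d p = - 8 * p$3 * (3 * (p$3)^2 + (p$1)^2 + (p$2)^2)"
| "hessian_det Surf_e p = 8 * p$1 * (p$2)^2 - 8 * p$1 * (p$3)^2 - 24 * p$2 * (p$3)^2"

fun dhessian_det :: "surface_label \<Rightarrow> real^3 \<Rightarrow> real^3 \<Rightarrow> real" where
  "dhessian_det Surf_a p v = 2 * (p$2 * p$3 * v$1 + p$1 * p$3 * v$2 + p$1 * p$2 * v$3)"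
| "dhessian_det Surf_b p v = 24 * (p$1)^2 * v$1"
| "dhessian_det Surf_c p v = 2 * (p$2 * p$3 * v$1 + p$1 * p$3 * v$2 + p$1 * p$2 * v$3) - 18 * (p$1)^2 * v$1"
| "dhessian_det Surf_d p v = - 16 * p$1 * p$3 * v$1 - 16 * p$2 * p$3 * v$2 - 8 * (9 * (p$3)^2 + (p$1)^2 + (p$2)^2) * v$3"
| "dhessian_det Surf_e p v = 8 * ((p$2)^2 - (p$3)^2) * v$1 + (16 * p$1 * p$2 - 24 * (p$3)^2) * v$2
     - (16 * p$1 * p$3 + 48 * p$2 * p$3) * v$3"

fun ddhessian_det :: "surface_label \<Rightarrow> real^3 \<Rightarrow> real^3 \<Rightarrow> real^3 \<Rightarrow> real" where
  "ddhessian_det Surf_a p u v = 2 * (p$1 * (u$2 * v$3 + u$3 * v$2) + p$2 * (u$1 * v$3 + u$3 * v$1) + p$3 * (u$1 * v$2 + u$2 * v$1))"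
| "ddhessian_det Surf_b p u v = 48 * p$1 * u$1 * v$1"
| "ddhessian_det Surf_c p u v = 2 * (p$1 * (u$2 * v$3 + u$3 * v$2) + p$2 * (u$1 * v$3 + u$3 * v$1) + p$3 * (u$1 * v$2 + u$2 * v$1))
     - 36 * p$1 * u$1 * v$1"
| "ddhessian_det Surf_d p u v = - 16 * p$3 * (u$1 * v$1 + u$2 * v$2 + 9 * u$3 * v$3) - 16 * p$1 * (u$1 * v$3 + u$3 * v$1)
     - 16 * p$2 * (u$2 * v$3 + u$3 * v$2)"
| "ddhessian_det Surf_e p u v = 16 * p$2 * (u$1 * v$2 + u$2 * v$1) - 16 * p$3 * (u$1 * v$3 + u$3 * v$1) + 16 * p$1 * u$2 * v$2
     - 48 * p$3 * (u$2 * v$3 + u$3 * v$2) - (16 * p$1 + 48 * p$2) * u$3 * v$3"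

text \<open>Written out as polynomials, determinant and adjugate enter only through the identities
  \<open>ddcubic_adj\<close> and \<open>ddcubic_trace_adj\<close>.\<close>

fun hessian_adj :: "surface_label \<Rightarrow> real^3 \<Rightarrow> real^3 \<Rightarrow> real^3" where
  "hessian_adj Surf_a p \<alpha> = (let x = p$1; y = p$2; z = p$3; a = \<alpha>$1; b = \<alpha>$2; c = \<alpha>$3 in
     vector [- (x^2 * a) + x * y * b + x * z * c, x * y * a - y^2 * b + y * z * c, x * z * a + y * z * b - z^2 * c])"
| "hessian_adj Surf_b p \<alpha> = (let x = p$1; y = p$2; z = p$3; a = \<alpha>$1; b = \<alpha>$2; c = \<alpha>$3 in
     vector [4 * x^2 * b, 4 * x^2 * a - (4 * x * y + 4 * z^2) * b - 4 * x * z * c, - 4 * x * z * b - 4 * x^2 * c])"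
| "hessian_adj Surf_c p \<alpha> = (let x = p$1; y = p$2; z = p$3; a = \<alpha>$1; b = \<alpha>$2; c = \<alpha>$3 in
     vector [- (x^2 * a) + x * y * b + x * z * c, x * y * a - y^2 * b + (y * z - 6 * x^2) * c,
             x * z * a + (y * z - 6 * x^2) * b - z^2 * c])"
| "hessian_adj Surf_d p \<alpha> = (let x = p$1; y = p$2; z = p$3; a = \<alpha>$1; b = \<alpha>$2; c = \<alpha>$3 in
     vector [- (12 * z^2 + 4 * y^2) * a + 4 * x * y * b - 4 * x * z * c, 4 * x * y * a - (12 * z^2 + 4 * x^2) * b - 4 * y * z * c,
             - 4 * x * z * a - 4 * y * z * b + 4 * z^2 * c])"
| "hessian_adj Surf_e p \<alpha> = (let x = p$1; y = p$2; z = p$3; a = \<alpha>$1; b = \<alpha>$2; c = \<alpha>$3 in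
     vector [- (4 * x^2 + 12 * x * y) * a + 4 * x * y * b + (4 * x * z + 12 * y * z) * c, 4 * x * y * a - 4 * z^2 * b - 4 * y * z * c,
             (4 * x * z + 12 * y * z) * a - 4 * y * z * b - 4 * y^2 * c])"

lemma vector_3_eq_axis:
  "(vector [a, b, c] :: real^3) = a *\<^sub>R axis 1 1 + b *\<^sub>R axis 2 1 + c *\<^sub>R axis 3 1"
  by (simp add: vec_eq_iff forall_3 axis_def)

lemma nth_differentiable: "(\<lambda>p::real^3. p $ i) differentiable at x"
  using nth_has_derivative differentiableI by blast

lemma hessian_det_derivative: "(hessian_det s has_derivative dhessian_det s p) (at p)"
proof -
  have "((\<lambda>p. hessian_det s p) has_derivative (\<lambda>v. dhessian_det s p v)) (at p)"
    by (cases s; simp only: hessian_det.simps dhessian_det.simps;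
        rule has_derivative_eq_rhs, (rule nth_has_derivative derivative_intros)+,
        simp add: fun_eq_iff power2_eq_square power3_eq_cube algebra_simps)
  then show ?thesis by simp
qed

lemma dhessian_det_derivative:
  "((\<lambda>p. dhessian_det s p v) has_derivative (\<lambda>u. ddhessian_det s p u v)) (at p)"
  by (cases s; simp only: dhessian_det.simps ddhessian_det.simps;
      rule has_derivative_eq_rhs, (rule nth_has_derivative derivative_intros)+,
      simp add: fun_eq_iff power2_eq_square algebra_simps)

lemma hessian_adj_differentiable: "(\<lambda>p. hessian_adj s p \<alpha>) differentiable at p"
  by (cases s; simp only: hessian_adj.simps Let_def vector_3_eq_axis; intro derivative_intros nth_differentiable)

text \<open>Jacobi's formula; the Hessian matrix of a cubic is linear in the point, so its
  derivative along \<open>v\<close> is its value at \<open>v\<close>.\<close>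

lemma ddcubic_trace_adj:
  "operator_trace (\<lambda>e. hessian_adj s p (covector (ddcubic s e v))) = dhessian_det s p v"
  by (cases s)
     (simp_all add: operator_trace_vec sum_3 covector_def axis_def Let_def power2_eq_square algebra_simps)

lemma ddcubic_adj: "ddcubic s p (hessian_adj s p \<alpha>) w = hessian_det s p * (\<alpha> \<bullet> w)"
  by (cases s)
     (simp_all add: inner_vec_def sum_3 Let_def power2_eq_square power3_eq_cube algebra_simps)

lemma ddcubic_diagonal: "ddcubic s p p p = 6 * cubic s p"
  by (cases s) (simp_all add: Let_def power2_eq_square power3_eq_cube algebra_simps)

lemma bilinear_ddcubic: "bilinear (ddcubic s p)"
  unfolding bilinear_def
  by (intro conjI allI linearI; cases s) (simp_all add: algebra_simps)

lemma bilinear_ddhessian_det: "bilinear (ddhessian_det s p)"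
  unfolding bilinear_def
  by (intro conjI allI linearI; cases s) (simp_all add: algebra_simps)

lemma linear_hessian_adj: "linear (hessian_adj s p)"
  by (intro linearI; cases s) (simp_all add: Let_def vec_eq_iff forall_3 algebra_simps)

lemma ddcubic_commute: "ddcubic s p u v = ddcubic s p v u"
  by (cases s) (simp_all add: algebra_simps)

lemma ddcubic_left_commute: "ddcubic s p u v = ddcubic s u p v"
  by (cases s) (simp_all add: algebra_simps)

section \<open>Positivity of the Hessian determinant on the cones\<close>

lemma region_c:
  assumes "p \<in> cubic_region Surf_c"
  shows "p$1 < 0" "p$2 > 0" "p$2 * p$3 < - ((p$1)^2)"
proof -
  show x: "p$1 < 0" "p$2 > 0" using assms by (auto simp: cubic_region_def)
  have "p$1 * (p$2 * p$3 + (p$1)^2) > 0" using assms by (auto simp: cubic_region_def Let_def)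
  then show "p$2 * p$3 < - ((p$1)^2)" using x by (auto simp: zero_less_mult_iff)
qed

lemma region_d:
  assumes "p \<in> cubic_region Surf_d"
  shows "p$3 < 0" "(p$1)^2 + (p$2)^2 < (p$3)^2"
proof -
  show x: "p$3 < 0" using assms by (auto simp: cubic_region_def)
  have "p$3 * ((p$1)^2 + (p$2)^2 - (p$3)^2) > 0" using assms by (auto simp: cubic_region_def Let_def)
  then show "(p$1)^2 + (p$2)^2 < (p$3)^2" using x by (auto simp: zero_less_mult_iff)
qed

text \<open>The sign is that of signature (1,2): the Hessian is positive on the position vector and
  negative on its orthogonal complement, the tangent plane of the surface. Here it is read off from
  the polynomials.\<close>

lemma hessian_det_pos:
  assumes "p \<in> cubic_region s"
  shows "hessian_det s p > 0"
proof (cases s)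
  case Surf_a
  then show ?thesis using assms by (simp add: cubic_region_def Let_def mult.assoc)
next
  case Surf_b
  then show ?thesis using assms by (simp add: cubic_region_def)
next
  case Surf_c
  note r = region_c[OF assms[unfolded Surf_c]]
  have "2 * p$1 * (p$2 * p$3 - 3 * (p$1)^2) > 0"
    using r zero_le_power2[of "p$1"] by (intro mult_neg_neg) (simp, linarith)
  then show ?thesis by (simp add: Surf_c power2_eq_square power3_eq_cube algebra_simps)
next
  case Surf_d
  note r = region_d[OF assms[unfolded Surf_d]]
  have "3 * (p$3)^2 + (p$1)^2 + (p$2)^2 > 0" using r by (simp add: add_pos_nonneg)
  then show ?thesis using r by (auto simp: Surf_d mult_neg_pos)
next
  case Surf_e
  then have h: "p$1 > 0" "p$2 < 0" "p$1 * ((p$2)^2 - (p$3)^2) + (p$2)^3 > 0"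
    using assms by (auto simp: cubic_region_def Let_def)
  have "p$2 * (p$3)^2 \<le> 0" "(p$2)^3 < 0" using h by (simp_all add: mult_nonpos_nonneg)
  then have "8 * (p$1 * ((p$2)^2 - (p$3)^2)) - 24 * (p$2 * (p$3)^2) > 0" using h by linarith
  then show ?thesis by (simp add: Surf_e algebra_simps)
qed

lemma cubic_form_surface:
  "cubic_form (cubic_region s) (ddcubic s) (hessian_adj s) (hessian_det s) (dhessian_det s) (ddhessian_det s)"
proof (rule cubic_form.intro)
  show "ddcubic s x x x > 0" if "x \<in> cubic_region s" for x
    using that by (simp add: ddcubic_diagonal cubic_region_def)
  show "hessian_det s x \<noteq> 0" if "x \<in> cubic_region s" for x
    using hessian_det_pos[OF that] by simp
qed (fact open_cubic_region bilinear_ddcubic ddcubic_commute ddcubic_left_commute linear_hessian_adj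
      hessian_adj_differentiable hessian_det_derivative dhessian_det_derivative bilinear_ddhessian_det
      ddcubic_adj ddcubic_trace_adj)+

definition hessian_log_det :: "surface_label \<Rightarrow> real^3 \<Rightarrow> real^3 \<Rightarrow> real^3 \<Rightarrow> real" where
  "hessian_log_det s p u v =
     ddhessian_det s p u v / hessian_det s p - dhessian_det s p u * dhessian_det s p v / (hessian_det s p)\<^sup>2"

text \<open>The quantity \<sigma> of the overview; it is homogeneous of degree 0.\<close>

definition reduced_curvature :: "surface_label \<Rightarrow> real^3 \<Rightarrow> real" where
  "reduced_curvature s p = cubic s p / hessian_det s p * operator_trace (\<lambda>e. hessian_adj s p (covector (hessian_log_det s p e)))"

text \<open>Along the ray through \<open>p\<close> the determinant grows like t^3, and 3 log t has
  second derivative -3 at t = 1.\<close>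

lemma hessian_log_det_diagonal:
  assumes "p \<in> cubic_region s"
  shows "hessian_log_det s p p p = - 3"
proof -
  have "dhessian_det s p p = 3 * hessian_det s p" "ddhessian_det s p p p = 6 * hessian_det s p"
    by (cases s; simp add: power2_eq_square power3_eq_cube algebra_simps)+
  then show ?thesis using hessian_det_pos[OF assms] by (simp add: hessian_log_det_def power2_eq_square)
qed

lemma scalar_curvature_surface:
  assumes "p \<in> fst (r_map (cubic s) (surface s))"
  shows "has_scalar_curvature (r_map (cubic s) (surface s)) p (2 * reduced_curvature s (Im_vec p) - 15)"
proof -
  interpret cubic_form "cubic_region s" "ddcubic s" "hessian_adj s" "hessian_det s" "dhessian_det s" "ddhessian_det s"
    by (rule cubic_form_surface)
  have p: "Im_vec p \<in> cubic_region s" using assms by (simp add: r_map_def positive_cone_surface)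
  have h: "h = cubic s" by (simp add: fun_eq_iff h_def ddcubic_diagonal)
  have \<theta>: "\<theta> = hessian_log_det s" by (simp add: fun_eq_iff \<theta>_def hessian_log_det_def)
  show ?thesis
    using scalar_curvature_r_map[OF p]
    by (simp add: r_map_def positive_cone_surface reduced_curvature_def h \<theta> Let_def hessian_log_det_diagonal[OF p] mult.assoc)
qed

lemma pseudo_riemannian_surface: "pseudo_riemannian (r_map (cubic s) (surface s))"
proof -
  interpret cubic_form "cubic_region s" "ddcubic s" "hessian_adj s" "hessian_det s" "dhessian_det s" "ddhessian_det s"
    by (rule cubic_form_surface)
  have h: "h = cubic s" by (simp add: fun_eq_iff h_def ddcubic_diagonal)
  show ?thesis using pseudo_riemannian_M by (simp add: r_map_def positive_cone_surface h)
qed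

text \<open>The square of the gradient in the Hessian of log d is of rank one, so its trace is a
  single value. With the denominators cleared, each surface needs only a polynomial
  computation.\<close>

lemma reduced_curvature_eq:
  assumes "p \<in> cubic_region s"
  shows "reduced_curvature s p = cubic s p *
     (hessian_det s p * operator_trace (\<lambda>e. hessian_adj s p (covector (ddhessian_det s p e)))
      - dhessian_det s p (hessian_adj s p (covector (dhessian_det s p)))) / (hessian_det s p)^3"
proof -
  note nz = hessian_det_pos[OF assms]
  interpret l: linear "dhessian_det s p" using hessian_det_derivative has_derivative_linear by blast
  interpret N: linear "hessian_adj s p" by (rule linear_hessian_adj)
  let ?d = "hessian_det s p"
  have "covector (hessian_log_det s p e) = (1 / ?d) *\<^sub>R covector (ddhessian_det s p e)
      - (1 / ?d\<^sup>2) *\<^sub>R (dhessian_det s p e *\<^sub>R covector (dhessian_det s p))" for e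
    by (simp add: covector_def vec_eq_iff hessian_log_det_def)
  then have trace: "operator_trace (\<lambda>e. hessian_adj s p (covector (hessian_log_det s p e))) =
    (1 / ?d) * operator_trace (\<lambda>e. hessian_adj s p (covector (ddhessian_det s p e)))
     - (1 / ?d\<^sup>2) * dhessian_det s p (hessian_adj s p (covector (dhessian_det s p)))"
    by (simp only: N.diff N.scale operator_trace_simps operator_trace_rank_one[OF l.linear_axioms])
  show ?thesis using nz
    unfolding reduced_curvature_def trace by (simp add: field_simps power2_eq_square power3_eq_cube)
qed

section \<open>The range of the reduced curvature on each cone\<close>

lemmas reduced_curvature_simps = operator_trace_vec sum_3 covector_def axis_def Let_def

lemma reduced_curvature_a:
  assumes "p \<in> cubic_region Surf_a" shows "reduced_curvature Surf_a p = 3/2"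
proof -
  have "p$1 \<noteq> 0" "p$2 \<noteq> 0" "p$3 \<noteq> 0" using assms by (auto simp: cubic_region_def)
  then show ?thesis unfolding reduced_curvature_eq[OF assms]
    by (simp add: reduced_curvature_simps field_simps power2_eq_square power3_eq_cube)
qed

lemma reduced_curvature_b:
  assumes "p \<in> cubic_region Surf_b" shows "reduced_curvature Surf_b p = 0"
  unfolding reduced_curvature_eq[OF assms]
  by (simp add: reduced_curvature_simps field_simps power2_eq_square power3_eq_cube)

lemma reduced_curvature_c:
  assumes p: "p \<in> cubic_region Surf_c" shows "0 < reduced_curvature Surf_c p" "reduced_curvature Surf_c p < 3/2"
proof -
  define x q where xq: "x = p$1" "q = p$2 * p$3"
  note r = region_c[OF p, folded xq]
  have x2: "x^2 > 0" using r by simp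
  have d: "hessian_det Surf_c p = 2 * x * (q - 3 * x^2)"
    by (simp add: xq power2_eq_square power3_eq_cube algebra_simps)
  have num: "cubic Surf_c p * (hessian_det Surf_c p * operator_trace (\<lambda>e. hessian_adj Surf_c p (covector (ddhessian_det Surf_c p e)))
      - dhessian_det Surf_c p (hessian_adj Surf_c p (covector (dhessian_det Surf_c p))))
    = 12 * x^3 * ((q + x^2) * (q^2 + 6 * q * x^2 + 21 * x^4))"
    by (simp add: reduced_curvature_simps xq power2_eq_square power3_eq_cube power4_eq_xxxx algebra_simps)
  have "x^3 \<noteq> 0" using r by simp
  then have e: "reduced_curvature Surf_c p = 3/2 * ((q + x^2) * (q^2 + 6 * q * x^2 + 21 * x^4) / (q - 3 * x^2)^3)"
    unfolding reduced_curvature_eq[OF p] num unfolding d by (simp add: power_mult_distrib)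
  \<comment> \<open>Completing the square in \<open>q\<close> for the quadratic factor of the
    numerator.\<close>
  have "(q + 3 * x^2)^2 + 12 * x^4 > 0" using r by (intro add_nonneg_pos) auto
  then have f: "q^2 + 6 * q * x^2 + 21 * x^4 > 0"
    by (simp add: power2_eq_square power4_eq_xxxx algebra_simps)
  have "q - 3 * x^2 < 0" using r(3) x2 by linarith
  then have g: "(q - 3 * x^2)^3 < 0" by simp
  have "q + x^2 < 0" using r by simp
  then show "0 < reduced_curvature Surf_c p" unfolding e using f g by (simp add: divide_neg_neg mult_neg_pos)
  \<comment> \<open>The denominator is negative, so the bound 3/2 means that the numerator exceeds
    it.\<close>
  have "(q + x^2) * (q^2 + 6 * q * x^2 + 21 * x^4) - (q - 3 * x^2)^3 = 16 * q^2 * x^2 + 48 * x^6"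
    by (simp add: power2_eq_square power3_eq_cube eval_nat_numeral algebra_simps)
  also have "\<dots> > 0" using r by (intro add_nonneg_pos) auto
  finally show "reduced_curvature Surf_c p < 3/2" unfolding e using g by (simp add: divide_less_eq)
qed

text \<open>Over the complex numbers this cubic is a constant multiple of that of
  \<open>Surf_c\<close>; putting -z^2 for x^2 and r for q carries the formula over, but now the
  denominator is positive.\<close>

lemma reduced_curvature_d:
  assumes p: "p \<in> cubic_region Surf_d" shows "reduced_curvature Surf_d p < 0"
proof -
  define z r where zr: "z = p$3" "r = (p$1)^2 + (p$2)^2"
  note rr = region_d[OF p, folded zr]
  have d: "hessian_det Surf_d p = - 8 * z * (3 * z^2 + r)" by (simp add: zr)
  have num: "cubic Surf_d p * (hessian_det Surf_d p * operator_trace (\<lambda>e. hessian_adj Surf_d p (covector (ddhessian_det Surf_d p e)))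
      - dhessian_det Surf_d p (hessian_adj Surf_d p (covector (dhessian_det Surf_d p))))
    = - 768 * z^3 * ((r - z^2) * (r^2 - 6 * r * z^2 + 21 * z^4))"
    by (simp add: reduced_curvature_simps zr power2_eq_square power3_eq_cube power4_eq_xxxx algebra_simps)
  have "z^3 < 0" using rr by simp
  moreover have "(r - 3 * z^2)^2 + 12 * z^4 > 0" using rr by (intro add_nonneg_pos) auto
  then have "r^2 - 6 * r * z^2 + 21 * z^4 > 0"
    by (simp add: power2_eq_square power4_eq_xxxx algebra_simps)
  ultimately have "- 768 * z^3 * ((r - z^2) * (r^2 - 6 * r * z^2 + 21 * z^4)) < 0"
    using rr by (intro mult_pos_neg mult_neg_pos) auto
  then show ?thesis
    unfolding reduced_curvature_eq[OF p] num using hessian_det_pos[OF p] by (intro divide_neg_pos) auto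
qed

text \<open>On the slice z = 0 the value is (3/2) (x + y) (x + 3y) / x^2. Inside the cone x + y > 0
  there, so the sign changes at x = -3y, and the two points lie on either side.\<close>

lemma reduced_curvature_e:
  shows "vector [2, -1, 0] \<in> cubic_region Surf_e" "reduced_curvature Surf_e (vector [2, -1, 0]) < 0"
    and "vector [4, -1, 0] \<in> cubic_region Surf_e" "reduced_curvature Surf_e (vector [4, -1, 0]) > 0"
proof -
  show 1: "vector [2, -1, 0] \<in> cubic_region Surf_e" and 2: "vector [4, -1, 0] \<in> cubic_region Surf_e"
    by (simp_all add: cubic_region_def Let_def)
  show "reduced_curvature Surf_e (vector [2, -1, 0]) < 0" "reduced_curvature Surf_e (vector [4, -1, 0]) > 0"
    unfolding reduced_curvature_eq[OF 1] reduced_curvature_eq[OF 2] by (simp_all add: reduced_curvature_simps)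
qed

text \<open>The same affine function turns \<sigma> into scalar curvature for all five labels, so an
  isometry preserves \<sigma>, and as a bijection it preserves the range. Every point of the cone is
  an imaginary part, so the ranges may be taken over the cones.\<close>

lemma isometric_reduced_curvature:
  assumes "isometric_riemannian (r_map (cubic s) (surface s)) (r_map (cubic t) (surface t))"
  shows "reduced_curvature s ` cubic_region s = reduced_curvature t ` cubic_region t"
proof -
  let ?M = "\<lambda>s. r_map (cubic s) (surface s)"
  obtain f where f: "riemannian_isometry (?M s) (?M t) f"
    using assms unfolding isometric_riemannian_def by blast
  have bij: "f ` fst (?M s) = fst (?M t)"
    using f by (simp add: riemannian_isometry_def bij_betw_def)
  have "reduced_curvature s (Im_vec z) = reduced_curvature t (Im_vec (f z))" if "z \<in> fst (?M s)" for z
    using scalar_curvature_isometry_invariant[OF f pseudo_riemannian_surface pseudo_riemannian_surface that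
        scalar_curvature_surface[OF that] scalar_curvature_surface] that bij by auto
  then have "(\<lambda>z. reduced_curvature s (Im_vec z)) ` fst (?M s) = (\<lambda>z. reduced_curvature t (Im_vec z)) ` f ` fst (?M s)"
    by (simp add: image_image cong: image_cong)
  then have *: "(\<lambda>z. reduced_curvature s (Im_vec z)) ` fst (?M s) = (\<lambda>z. reduced_curvature t (Im_vec z)) ` fst (?M t)"
    by (simp only: bij)
  have "Im_vec ` fst (?M s) = cubic_region s" for s
  proof (intro equalityI subsetI)
    fix x assume "x \<in> cubic_region s"
    then have "complex_vec 0 x \<in> fst (?M s)" by (simp add: r_map_def positive_cone_surface)
    then show "x \<in> Im_vec ` fst (?M s)" by (rule rev_image_eqI) simp
  qed (auto simp: r_map_def positive_cone_surface)
  with * show ?thesis by (metis (no_types) image_image)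
qed

theorem proposition9:
  fixes s t :: surface_label
  assumes "s \<noteq> t"
  shows "\<not> isometric_riemannian (r_map (cubic s) (surface s)) (r_map (cubic t) (surface t))"
proof
  let ?R = "\<lambda>s. reduced_curvature s ` cubic_region s"
  assume "isometric_riemannian (r_map (cubic s) (surface s)) (r_map (cubic t) (surface t))"
  then have eq: "?R s = ?R t" by (rule isometric_reduced_curvature)
  \<comment> \<open>The ranges for (a) to (d) are pairwise disjoint, so equality is excluded once
    they are nonempty; the range for (e) meets both signs, which none of the others does.\<close>
  have "\<exists>v. v \<in> ?R s" for s using cubic_region_nonempty by blast
  moreover have "v \<in> ?R Surf_a \<Longrightarrow> v = 3/2" "v \<in> ?R Surf_b \<Longrightarrow> v = 0" "v \<in> ?R Surf_c \<Longrightarrow> 0 < v \<and> v < 3/2"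
    "v \<in> ?R Surf_d \<Longrightarrow> v < 0" for v
    using reduced_curvature_a reduced_curvature_b reduced_curvature_c reduced_curvature_d by auto
  moreover have "\<exists>v\<in>?R Surf_e. v < 0" "\<exists>v\<in>?R Surf_e. v > 0" using reduced_curvature_e by blast+
  ultimately show False
    using eq assms by (cases s; cases t) (metis less_irrefl less_asym zero_less_divide_iff zero_less_numeral)+
qed

end
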